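(* There is an algorithm that, given a graph $G$ with $n$ vertices together with the set of all its minimal separators, computes $\mathrm{tcl}(G)$ in time $O(2.4423^n)$ (and space $O(2^n)$).
   Context: All graphs are finite, simple and undirected. In exponential bounds $O(c^n)$, polynomial factors in $n$ are suppressed. For non-adjacent vertices $a,b$, a set $S\subseteq V(G)$ is an $a,b$-separator if $a,b$ lie in different components of $G-S$; it is a minimal $a,b$-separator if no proper subset is an $a,b$-separator; $S$ is a minimal separator of $G$ if it is a minimal $a,b$-separator for some $a,b$. For $X\subseteq V(G)$ let $\mathrm{vcc}(X)$ be the minimum number of cliques of $G$ whose union is $X$. A tree decomposition of $G$ is a pair $(T,\{X_t\}_{t\in V(T)})$ with $T$ a tree and bags $X_t\subseteq V(G)$ such that every vertex lies in some bag, both endpoints of every edge lie in a common bag, and for every vertex $v$ the nodes $t$ with $v\in X_t$ induce a connected subtree of $T$. An augmented tree decomposition additionally assigns to each node $t$ a collection $C_t$ of cliques of $G$ whose union is $X_t$; its width is $\max_t |C_t|$. The tree-clique width $\mathrm{tcl}(G)$ is the minimum width of an augmented tree decomposition of $G$, i.e. the minimum over tree decompositions of $\max_t \mathrm{vcc}(X_t)$. *)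

theory Defs
  imports Complex_Main "HOL-Library.Landau_Symbols" "HOL-Library.Log_Nat"
begin

section \<open>Graphs\<close>

text \<open>A graph is given by a vertex set \<open>V\<close> and a set \<open>E\<close> of two-element edges.\<close>

definition simple_graph :: "'a set \<Rightarrow> 'a set set \<Rightarrow> bool" where
  "simple_graph V E \<longleftrightarrow> finite V \<and> (\<forall>e\<in>E. e \<subseteq> V \<and> card e = 2)"

text \<open>In the next three definitions \<open>U\<close> is a set of vertices and the graph meant is the
  subgraph that \<open>U\<close> induces in the graph with edge set \<open>E\<close>.\<close>

definition reachable :: "'a set set \<Rightarrow> 'a set \<Rightarrow> 'a \<Rightarrow> 'a \<Rightarrow> bool" where
  "reachable E U u v \<longleftrightarrow>
     u \<in> U \<and> v \<in> U \<and> (u, v) \<in> {(x, y). x \<in> U \<and> y \<in> U \<and> {x, y} \<in> E}\<^sup>*"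

definition components :: "'a set set \<Rightarrow> 'a set \<Rightarrow> 'a set set" where
  "components E U = {{v. reachable E U u v} | u. u \<in> U}"

definition connected_graph :: "'a set set \<Rightarrow> 'a set \<Rightarrow> bool" where
  "connected_graph E U \<longleftrightarrow> U \<noteq> {} \<and> (\<forall>u\<in>U. \<forall>v\<in>U. reachable E U u v)"

definition cycle :: "'a set set \<Rightarrow> 'a list \<Rightarrow> bool" where
  "cycle E p \<longleftrightarrow> 3 \<le> length p \<and> distinct p \<and>
     (\<forall>i<length p. {p ! i, p ! (Suc i mod length p)} \<in> E)"

definition tree :: "'a set \<Rightarrow> 'a set set \<Rightarrow> bool" where
  "tree V E \<longleftrightarrow> simple_graph V E \<and> connected_graph E V \<and> (\<nexists>p. cycle E p)"

definition clique :: "'a set \<Rightarrow> 'a set set \<Rightarrow> 'a set \<Rightarrow> bool" where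
  "clique V E K \<longleftrightarrow> K \<subseteq> V \<and> (\<forall>u\<in>K. \<forall>v\<in>K. u \<noteq> v \<longrightarrow> {u, v} \<in> E)"


section \<open>Minimal separators\<close>

definition separator :: "'a set \<Rightarrow> 'a set set \<Rightarrow> 'a \<Rightarrow> 'a \<Rightarrow> 'a set \<Rightarrow> bool" where
  "separator V E a b S \<longleftrightarrow> S \<subseteq> V \<and>
     (\<exists>A\<in>components E (V - S). \<exists>B\<in>components E (V - S). a \<in> A \<and> b \<in> B \<and> A \<noteq> B)"

definition minimal_separator_between ::
    "'a set \<Rightarrow> 'a set set \<Rightarrow> 'a \<Rightarrow> 'a \<Rightarrow> 'a set \<Rightarrow> bool" where
  "minimal_separator_between V E a b S \<longleftrightarrow>
     separator V E a b S \<and> (\<forall>S'. S' \<subset> S \<longrightarrow> \<not> separator V E a b S')"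

definition minimal_separator :: "'a set \<Rightarrow> 'a set set \<Rightarrow> 'a set \<Rightarrow> bool" where
  "minimal_separator V E S \<longleftrightarrow>
     (\<exists>a\<in>V. \<exists>b\<in>V. a \<noteq> b \<and> {a, b} \<notin> E \<and> minimal_separator_between V E a b S)"


section \<open>Tree-clique width\<close>

definition tree_decomposition ::
    "'a set \<Rightarrow> 'a set set \<Rightarrow> 't set \<Rightarrow> 't set set \<Rightarrow> ('t \<Rightarrow> 'a set) \<Rightarrow> bool" where
  "tree_decomposition V E VT ET X \<longleftrightarrow>
     tree VT ET \<and>
     (\<forall>t\<in>VT. X t \<subseteq> V) \<and>
     (\<forall>v\<in>V. \<exists>t\<in>VT. v \<in> X t) \<and>
     (\<forall>e\<in>E. \<exists>t\<in>VT. e \<subseteq> X t) \<and>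
     (\<forall>v\<in>V. connected_graph ET {t\<in>VT. v \<in> X t})"

definition augmented_tree_decomposition ::
    "'a set \<Rightarrow> 'a set set \<Rightarrow> 't set \<Rightarrow> 't set set \<Rightarrow> ('t \<Rightarrow> 'a set) \<Rightarrow>
     ('t \<Rightarrow> 'a set set) \<Rightarrow> bool" where
  "augmented_tree_decomposition V E VT ET X C \<longleftrightarrow>
     tree_decomposition V E VT ET X \<and>
     (\<forall>t\<in>VT. (\<forall>K\<in>C t. clique V E K) \<and> \<Union>(C t) = X t)"

definition width :: "'t set \<Rightarrow> ('t \<Rightarrow> 'a set set) \<Rightarrow> nat" where
  "width VT C = Max ((\<lambda>t. card (C t)) ` VT)"

text \<open>Since decomposition trees are finite, it is no restriction to take natural numbers
  as their nodes.\<close>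

definition tcl :: "'a set \<Rightarrow> 'a set set \<Rightarrow> nat" where
  "tcl V E = (LEAST k. \<exists>(VT :: nat set) ET X C.
     augmented_tree_decomposition V E VT ET X C \<and> width VT C = k)"


section \<open>Random access machine programs at logarithmic cost\<close>

text \<open>
  Programs are structured programs for a random access machine whose memory is divided into
  arrays of natural numbers. Array names are literals in the program text, so a program uses
  finitely many arrays; indices are computed, of any size. Scalar variables are array cells
  with constant index.

  Costs are logarithmic: memory accesses are charged the bit lengths of the index and of the
  value, and operators are charged the product of the operand lengths, which covers schoolbook
  arithmetic. In particular long numbers cannot be used to obtain parallelism for free.
\<close>

type_synonym state = "nat \<Rightarrow> nat \<Rightarrow> nat"

datatype bop = Plus | Minus | Times | Div | Mod | BitAnd | BitOr | BitXor | Less | Equal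

datatype aexp = Const nat | Cell nat aexp | Bop bop aexp aexp

datatype com =
    Skip
  | Store nat aexp aexp
  | Seq com com
  | Cond aexp com com
  | While aexp com

abbreviation len :: "nat \<Rightarrow> nat" where
  "len \<equiv> floorlog 2"

text \<open>Subtraction is truncated, and \<open>a div 0 = 0\<close>, \<open>a mod 0 = a\<close>, as always on \<open>nat\<close>.\<close>

fun bop_val :: "bop \<Rightarrow> nat \<Rightarrow> nat \<Rightarrow> nat" where
  "bop_val Plus a b = a + b"
| "bop_val Minus a b = a - b"
| "bop_val Times a b = a * b"
| "bop_val Div a b = a div b"
| "bop_val Mod a b = a mod b"
| "bop_val BitAnd a b = Bit_Operations.and a b"
| "bop_val BitOr a b = Bit_Operations.or a b"
| "bop_val BitXor a b = Bit_Operations.xor a b"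
| "bop_val Less a b = (if a < b then 1 else 0)"
| "bop_val Equal a b = (if a = b then 1 else 0)"

fun aval :: "aexp \<Rightarrow> state \<Rightarrow> nat" where
  "aval (Const k) s = k"
| "aval (Cell x e) s = s x (aval e s)"
| "aval (Bop f e1 e2) s = bop_val f (aval e1 s) (aval e2 s)"

fun acost :: "aexp \<Rightarrow> state \<Rightarrow> nat" where
  "acost (Const k) s = 1 + len k"
| "acost (Cell x e) s = 1 + acost e s + len (aval e s) + len (s x (aval e s))"
| "acost (Bop f e1 e2) s =
     acost e1 s + acost e2 s + (1 + len (aval e1 s)) * (1 + len (aval e2 s))"

text \<open>The space taken by a state, in bits. Cells containing 0 are free; their contents are
  determined by the cells that are charged for. The initial states below have finite support,
  which every program preserves, so the sum is over a finite set.\<close>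

definition state_size :: "state \<Rightarrow> nat" where
  "state_size s = (\<Sum>(x, i) \<in> {(x, i). s x i \<noteq> 0}. 1 + len i + len (s x i))"

text \<open>\<open>big_step c s t m s'\<close>: started in \<open>s\<close>, the program \<open>c\<close> halts in \<open>s'\<close> after time \<open>t\<close>,
  and \<open>m\<close> is the largest size of a state occurring on the way, \<open>s\<close> and \<open>s'\<close> included.\<close>

inductive big_step :: "com \<Rightarrow> state \<Rightarrow> nat \<Rightarrow> nat \<Rightarrow> state \<Rightarrow> bool" where
  Skip: "big_step Skip s 1 (state_size s) s"
| Store: "\<lbrakk> i = aval e1 s; v = aval e2 s; s' = s(x := (s x)(i := v)) \<rbrakk> \<Longrightarrow>
     big_step (Store x e1 e2) s
       (1 + acost e1 s + acost e2 s + len i + len v) (max (state_size s) (state_size s')) s'"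
| Seq: "\<lbrakk> big_step c1 s t1 m1 s'; big_step c2 s' t2 m2 s'' \<rbrakk> \<Longrightarrow>
     big_step (Seq c1 c2) s (t1 + t2) (max m1 m2) s''"
| CondTrue: "\<lbrakk> aval e s \<noteq> 0; big_step c1 s t m s' \<rbrakk> \<Longrightarrow>
     big_step (Cond e c1 c2) s (1 + acost e s + t) m s'"
| CondFalse: "\<lbrakk> aval e s = 0; big_step c2 s t m s' \<rbrakk> \<Longrightarrow>
     big_step (Cond e c1 c2) s (1 + acost e s + t) m s'"
| WhileFalse: "aval e s = 0 \<Longrightarrow>
     big_step (While e c) s (1 + acost e s) (state_size s) s"
| WhileTrue: "\<lbrakk> aval e s \<noteq> 0; big_step c s t1 m1 s'; big_step (While e c) s' t2 m2 s'' \<rbrakk> \<Longrightarrow>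
     big_step (While e c) s (1 + acost e s + t1 + t2) (max m1 m2) s''"


section \<open>Input, result and growth rates\<close>

text \<open>Input for a graph with vertices \<open>0, \<dots>, n - 1\<close> and a list of vertex sets: array 0 holds
  \<open>n\<close> and the length of the list, array 1 the adjacency matrix row by row, and array 2 the
  characteristic vectors of the listed sets one after the other. All other cells are 0.\<close>

definition input_state :: "nat \<Rightarrow> nat set set \<Rightarrow> nat set list \<Rightarrow> state" where
  "input_state n E Ss x i =
     (if x = 0 \<and> i = 0 then n
      else if x = 0 \<and> i = 1 then length Ss
      else if x = 1 \<and> i < n * n \<and> {i div n, i mod n} \<in> E then 1
      else if x = 2 \<and> i < length Ss * n \<and> i mod n \<in> Ss ! (i div n) then 1
      else 0)"

definition result :: "state \<Rightarrow> nat" where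
  "result s = s 0 0"

text \<open>Functions in \<open>O(c\<^sup>n)\<close> up to factors polynomial in \<open>n\<close>.\<close>

definition O_star :: "real \<Rightarrow> (nat \<Rightarrow> real) set" where
  "O_star c = {f. \<exists>k. f \<in> O(\<lambda>n. real n ^ k * c ^ n)}"

end

theory Submission
  imports Defs
begin

text \<open>
  The tree-clique width is at most \<open>k\<close> iff the vertices can be eliminated one by one such that
  every vertex \<open>v\<close>, together with the remaining vertices that it reaches through eliminated ones,
  is covered by \<open>k\<close> cliques. For one direction, eliminate the vertices by decreasing
  distance of their topmost bag from the root of a decomposition tree; for the other, take the sets
  just described as bags and join each to that of its next eliminated member. These sets depend
  only on the set eliminated so far, so dynamic programming over all vertex sets decides \<open>k\<close>.

  The sets covered by \<open>k\<close> cliques are found by counting: the number of \<open>k\<close>-tuples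
  of cliques with union inside \<open>X\<close> is the \<open>k\<close>-th power of the number of cliques inside
  \<open>X\<close>, and Moebius inversion turns it into the number of tuples with union exactly \<open>X\<close>.
  Inverting one vertex at a time, all intermediate values are numbers of tuples, so that natural
  number subtraction is never truncated. Everything takes time and space \<open>2\<^sup>n\<close> up to
  polynomial factors.
\<close>


section \<open>Elimination orders\<close>

text \<open>A family of at most \<open>k\<close> cliques is replaced by a list of exactly
  \<open>k\<close> cliques. Order and repetition make the number of lists a plain power, and the
  empty clique pads short families, so the existence of a cover is unaffected. There are at most
  \<open>2 ^ n\<close> cliques, and only \<open>k < n\<close> is tested, so every count is at most
  \<open>2 ^ (n * n)\<close>; its bit length is polynomial, and so is the price of one operation at
  logarithmic cost. Exponential time can then come only from loops over all masks. Testing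
  \<open>k < n\<close> suffices because singletons always cover with \<open>n\<close> cliques. Since
  eliminability persists as \<open>k\<close> grows, the number of failing \<open>k\<close> is the
  width itself. Resource bounds are kept coarse: one index bound and one word length hold during the
  whole run, and loop lengths are read off a fixed nominal state.\<close>

definition clique_coverable :: "'a set \<Rightarrow> 'a set set \<Rightarrow> nat \<Rightarrow> 'a set \<Rightarrow> bool" where
  "clique_coverable V E k B \<longleftrightarrow>
     (\<exists>C. finite C \<and> card C \<le> k \<and> (\<forall>K\<in>C. clique V E K) \<and> \<Union>C = B)"

text \<open>Only the source must lie in \<open>S\<close>, so a walk may end outside \<open>S\<close>
  but cannot continue from there.\<close>

definition out_edges :: "'a set set \<Rightarrow> 'a set \<Rightarrow> ('a \<times> 'a) set" where
  "out_edges E S = {(x, y). x \<in> S \<and> {x, y} \<in> E}"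

text \<open>The bag of the elimination game: \<open>v\<close> with its later neighbours in the
  fill-in graph. \<open>S\<close> is meant to contain \<open>v\<close> already, which is why
  \<open>v\<close> is exempted from the removal.\<close>

definition elim_bag :: "'a set set \<Rightarrow> 'a set \<Rightarrow> 'a \<Rightarrow> 'a set" where
  "elim_bag E S v = {w. (v, w) \<in> (out_edges E S)\<^sup>*} - (S - {v})"

text \<open>The recursion peels off the member of \<open>S\<close> that is eliminated last, so that
  the premise again concerns a set of eliminated vertices.\<close>

inductive eliminable :: "'a set \<Rightarrow> 'a set set \<Rightarrow> nat \<Rightarrow> 'a set \<Rightarrow> bool"
  for V E k where
  empty: "eliminable V E k {}"
| step: "\<lbrakk> v \<in> S; v \<in> V; eliminable V E k (S - {v}); clique_coverable V E k (elim_bag E S v) \<rbrakk>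
    \<Longrightarrow> eliminable V E k S"

abbreviation adj_in :: "'a set set \<Rightarrow> 'a set \<Rightarrow> ('a \<times> 'a) set" where
  "adj_in E U \<equiv> {(x, y). x \<in> U \<and> y \<in> U \<and> {x, y} \<in> E}"

lemma sym_adj_in: "sym (adj_in E U)"
  by (auto simp: sym_def insert_commute)

lemma connected_graphI:
  assumes r: "r \<in> U" and to_r: "\<And>u. u \<in> U \<Longrightarrow> (u, r) \<in> (adj_in E U)\<^sup>*"
  shows "connected_graph E U"
proof -
  have "(u, v) \<in> (adj_in E U)\<^sup>*" if "u \<in> U" "v \<in> U" for u v
  proof -
    have "(r, v) \<in> (adj_in E U)\<^sup>*"
      using sym_rtrancl[OF sym_adj_in[of U E]] to_r[OF \<open>v \<in> U\<close>] by (rule symD)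
    then show ?thesis using to_r[OF \<open>u \<in> U\<close>] by (meson rtrancl_trans)
  qed
  then show ?thesis using r unfolding connected_graph_def reachable_def by blast
qed

lemma connected_graphD:
  "\<lbrakk> connected_graph E U; u \<in> U; v \<in> U \<rbrakk> \<Longrightarrow> (u, v) \<in> (adj_in E U)\<^sup>*"
  unfolding connected_graph_def reachable_def by blast

lemma connected_graph_insert:
  assumes "connected_graph E B" "b \<in> B" "{b, c} \<in> E"
  shows "connected_graph E (insert c B)"
proof (rule connected_graphI[of b])
  fix u assume u: "u \<in> insert c B"
  have mono: "(adj_in E B)\<^sup>* \<subseteq> (adj_in E (insert c B))\<^sup>*" by (rule rtrancl_mono) auto
  show "(u, b) \<in> (adj_in E (insert c B))\<^sup>*"
  proof (cases "u = c")
    case True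
    have "(c, b) \<in> adj_in E (insert c B)" using assms by (auto simp: insert_commute)
    then show ?thesis using True by blast
  next
    case False
    then show ?thesis using connected_graphD[OF assms(1) _ assms(2), of u] u mono by blast
  qed
qed (use assms in auto)

section \<open>Paths, cycles and rooted trees\<close>

lemma rtrancl_leaves:
  assumes "(x, y) \<in> R\<^sup>*" "x \<in> B" "y \<notin> B"
  shows "\<exists>b c. (b, c) \<in> R \<and> b \<in> B \<and> c \<notin> B"
  using assms by (induction rule: rtrancl_induct) auto

text \<open>Needed because \<open>cycle\<close> asks for a list without repetition. A walk that
  returns to a visited vertex is cut off there.\<close>

lemma rtrancl_distinct_path:
  assumes "(u, v) \<in> R\<^sup>*"
  shows "\<exists>xs. xs \<noteq> [] \<and> hd xs = u \<and> last xs = v \<and> distinct xs \<and> successively (\<lambda>x y. (x, y) \<in> R) xs"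
  using assms
proof (induction rule: rtrancl_induct)
  case base
  show ?case by (rule exI[of _ "[u]"]) auto
next
  case (step y z)
  then obtain xs where xs: "xs \<noteq> []" "hd xs = u" "last xs = y" "distinct xs"
    "successively (\<lambda>x y. (x, y) \<in> R) xs" by blast
  show ?case
  proof (cases "z \<in> set xs")
    case True
    then obtain as bs where split: "xs = as @ z # bs" by (meson split_list)
    then have "hd (as @ [z]) = u" "distinct (as @ [z])"
        "successively (\<lambda>x y. (x, y) \<in> R) (as @ [z])"
      using xs by (auto simp: hd_append successively_append_iff)
    then show ?thesis by (intro exI[of _ "as @ [z]"]) auto
  next
    case False
    then show ?thesis using xs step(2)
      by (intro exI[of _ "xs @ [z]"]) (auto simp: successively_append_iff)
  qed
qed

text \<open>\<open>rk\<close> takes the place of the distance from the root. It too drops strictly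
  along parents, but being injective it also identifies nodes, so ties need no separate
  treatment.\<close>

definition rooted :: "'t set set \<Rightarrow> 't set \<Rightarrow> 't \<Rightarrow> ('t \<Rightarrow> 't) \<Rightarrow> ('t \<Rightarrow> nat) \<Rightarrow> bool" where
  "rooted E B r p rk \<longleftrightarrow> r \<in> B \<and> (\<forall>t\<in>B - {r}. p t \<in> B \<and> rk (p t) < rk t) \<and> inj_on rk B \<and>
     (\<forall>e\<in>E. e \<subseteq> B \<longrightarrow> (\<exists>t\<in>B - {r}. e = {t, p t}))"

text \<open>Two edges from \<open>c\<close> into \<open>B\<close>, joined by a path inside
  \<open>B\<close>, would close a cycle.\<close>

lemma unique_edge_into_connected:
  assumes acyc: "\<nexists>q. cycle E q" and conn: "connected_graph E B"
    and b: "b \<in> B" "{b, c} \<in> E" and b': "b' \<in> B" "{b', c} \<in> E" and c: "c \<notin> B"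
  shows "b' = b"
proof (rule ccontr)
  assume neq: "b' \<noteq> b"
  obtain xs where xs: "xs \<noteq> []" "hd xs = b" "last xs = b'" "distinct xs"
    "successively (\<lambda>x y. (x, y) \<in> adj_in E B) xs"
    using rtrancl_distinct_path[OF connected_graphD[OF conn b(1) b'(1)]] by blast
  have succ: "(xs ! i, xs ! Suc i) \<in> adj_in E B" if "Suc i < length xs" for i
    using xs(5) that by (auto simp: successively_conv_nth)
  have len: "length xs \<ge> 2" using xs(1-3) neq
    by (metis One_nat_def Suc_1 Suc_leI hd_conv_nth last_conv_nth length_greater_0_conv
        diff_Suc_1 le_neq_implies_less)
  have inB: "set xs \<subseteq> B"
  proof
    fix x assume "x \<in> set xs"
    then obtain i where i: "i < length xs" "x = xs ! i" by (metis in_set_conv_nth)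
    show "x \<in> B"
    proof (cases "Suc i < length xs")
      case True then show ?thesis using succ[of i] i by auto
    next
      case False
      then have "i = length xs - 1" using i by auto
      then show ?thesis using xs(1,3) i b'(1) by (simp add: last_conv_nth)
    qed
  qed
  \<comment> \<open>First \<open>c\<close>, then the path from \<open>b\<close> to
    \<open>b'\<close>; the last index wraps around to the edge between \<open>b'\<close> and
    \<open>c\<close>.\<close>
  have "cycle E (c # xs)"
    unfolding cycle_def
  proof (intro conjI allI impI)
    show "3 \<le> length (c # xs)" using len by simp
    show "distinct (c # xs)" using xs(4) inB c by auto
    fix i assume i: "i < length (c # xs)"
    show "{(c # xs) ! i, (c # xs) ! (Suc i mod length (c # xs))} \<in> E"
    proof (cases i)
      case 0
      then show ?thesis using len xs(1,2) b(2) by (simp add: hd_conv_nth insert_commute)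
    next
      case (Suc j)
      show ?thesis
      proof (cases "Suc j < length xs")
        case True then show ?thesis using succ[of j] Suc by auto
      next
        case False
        then have j: "j = length xs - 1" "Suc j = length xs" using i Suc by auto
        have "last xs = xs ! j" unfolding j(1) by (rule last_conv_nth[OF xs(1)])
        then have "(c # xs) ! i = b'" using xs(3) Suc by simp
        moreover have "Suc i mod length (c # xs) = 0" using Suc j(2) by simp
        ultimately show ?thesis using b'(2) by simp
      qed
    qed
  qed
  then show False using acyc by blast
qed

text \<open>A connected set \<open>B\<close> grows by one node at a time. The new node
  \<open>c\<close> takes a neighbour \<open>b\<close> in \<open>B\<close> as parent; acyclicity
  forbids a second edge from \<open>c\<close> into \<open>B\<close>, so parent edges remain the only
  edges.\<close>

lemma tree_imp_rooted:
  assumes "tree VT ET"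
  shows "\<exists>r p rk. rooted ET VT r p rk"
proof -
  have sg: "simple_graph VT ET" and conn: "connected_graph ET VT" and acyc: "\<nexists>q. cycle ET q"
    using assms unfolding tree_def by auto
  have fin: "finite VT" and card2: "\<And>e. e \<in> ET \<Longrightarrow> e \<subseteq> VT \<and> card e = 2"
    using sg unfolding simple_graph_def by auto
  have ne: "VT \<noteq> {}" using conn unfolding connected_graph_def by auto
  have "\<exists>B\<subseteq>VT. card B = Suc j \<and> connected_graph ET B \<and> (\<exists>r p rk. rooted ET B r p rk)"
    if "Suc j \<le> card VT" for j
    using that
  proof (induction j)
    case 0
    obtain x where x: "x \<in> VT" using ne by auto
    have "e \<noteq> {} \<and> e \<noteq> {x}" if "e \<in> ET" for e using card2[OF that] by auto
    then have "rooted ET {x} x id (\<lambda>_. 0)"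
      unfolding rooted_def by (auto simp: subset_singleton_iff)
    moreover have "connected_graph ET {x}" by (rule connected_graphI[of x]) auto
    ultimately show ?case using x by (intro exI[of _ "{x}"]) auto
  next
    case (Suc j)
    then obtain B r p rk where B: "B \<subseteq> VT" "card B = Suc j" "connected_graph ET B"
      "rooted ET B r p rk" by auto
    have finB: "finite B" using B(1) fin finite_subset by blast
    obtain x where x: "x \<in> B" using B(2) by fastforce
    obtain y where y: "y \<in> VT" "y \<notin> B" using B Suc.prems by (metis card_mono fin finB leD lessI subset_iff order.strict_trans2 Suc_le_lessD)
    obtain b c where bc: "(b, c) \<in> adj_in ET VT" "b \<in> B" "c \<notin> B"
      using rtrancl_leaves[OF connected_graphD[OF conn _ y(1)] x y(2)] x B(1) by blast
    define p' where "p' = p(c := b)"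
    \<comment> \<open>A rank above all old ones gives both injectivity and the drop from
      \<open>c\<close> to its parent.\<close>
    define rk' where "rk' = rk(c := Suc (Max (rk ` B)))"
    have big: "rk t < rk' c" if "t \<in> B" for t
      using that finB by (simp add: rk'_def le_imp_less_Suc)
    have r: "r \<in> B" and pB: "\<And>t. t \<in> B - {r} \<Longrightarrow> p t \<in> B \<and> rk (p t) < rk t" and inj: "inj_on rk B"
      and edges: "\<And>e. e \<in> ET \<Longrightarrow> e \<subseteq> B \<Longrightarrow> \<exists>t\<in>B - {r}. e = {t, p t}"
      using B(4) unfolding rooted_def by auto
    have old: "rk' t = rk t" "p' t = p t" if "t \<in> B" for t using that bc unfolding rk'_def p'_def by auto
    have "rooted ET (insert c B) r p' rk'"
      unfolding rooted_def
    proof (intro conjI ballI impI)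
      show "r \<in> insert c B" using r by simp
      fix t assume t: "t \<in> insert c B - {r}"
      show "p' t \<in> insert c B" using t pB bc by (auto simp: p'_def)
      show "rk' (p' t) < rk' t"
      proof (cases "t = c")
        case True then show ?thesis using big[OF bc(2)] old(1)[OF bc(2)] by (simp add: p'_def)
      next
        case False then show ?thesis using t pB[of t] old by simp
      qed
    next
      show "inj_on rk' (insert c B)"
        unfolding inj_on_def using inj big old by (metis insert_iff inj_onD nat_neq_iff)
    next
      fix e assume e: "e \<in> ET" "e \<subseteq> insert c B"
      show "\<exists>t\<in>insert c B - {r}. e = {t, p' t}"
      proof (cases "c \<in> e")
        case False
        then have "e \<subseteq> B" using e(2) by blast
        then show ?thesis using edges[OF e(1)] old(2) by (metis DiffD1 DiffD2 DiffI insertI2)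
      next
        case True
        obtain b' where b': "e = {b', c}" "b' \<noteq> c" 
          using True card2[OF e(1)] by (metis card_2_iff doubleton_eq_iff insertE singletonD)
        then have "b' \<in> B" using e(2) by auto
        then have "b' = b"
          using unique_edge_into_connected[OF acyc B(3) bc(2) _ _ _ bc(3)] bc(1) b' e(1) by blast
        then show ?thesis using b' r bc by (intro bexI[of _ c]) (auto simp: p'_def)
      qed
    qed
    moreover have "connected_graph ET (insert c B)"
      using connected_graph_insert[OF B(3) bc(2)] bc(1) by auto
    ultimately show ?case using B bc finB by (intro exI[of _ "insert c B"]) auto
  qed
  moreover have card: "Suc (card VT - 1) = card VT" using ne fin by (simp add: card_gt_0_iff)
  ultimately have "\<exists>B\<subseteq>VT. card B = card VT \<and> connected_graph ET B \<and> (\<exists>r p rk. rooted ET B r p rk)"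
    by (metis le_refl)
  then obtain B where "B \<subseteq> VT" "card B = card VT" "\<exists>r p rk. rooted ET B r p rk" by blast
  then show ?thesis using card_subset_eq[OF fin] by blast
qed

definition parent_rel :: "'t set \<Rightarrow> 't \<Rightarrow> ('t \<Rightarrow> 't) \<Rightarrow> ('t \<times> 't) set" where
  "parent_rel B r p = {(t, p t) | t. t \<in> B - {r}}"

lemma rooted_rank_le:
  assumes "rooted E B r p rk" "(x, y) \<in> (parent_rel B r p)\<^sup>*"
  shows "rk y \<le> rk x"
  using assms(2)
proof (induction rule: rtrancl_induct)
  case (step y z)
  then show ?case using assms(1) unfolding rooted_def parent_rel_def by force
qed simp

text \<open>If the top node \<open>m\<close> of a connected set \<open>T\<close> differed from some \<open>t \<in> T\<close> with
  parent outside \<open>T\<close>, no edge inside \<open>T\<close> would lead out of the descendants of \<open>t\<close>.\<close>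

lemma rooted_connected_top:
  assumes rt: "rooted E B r p rk" and EB: "\<And>e. e \<in> E \<Longrightarrow> e \<subseteq> B"
    and T: "T \<subseteq> B" "connected_graph E T"
  shows "\<exists>m\<in>T. \<forall>t\<in>T. (t, m) \<in> (parent_rel B r p)\<^sup>* \<and>
    (\<forall>a. (t, a) \<in> (parent_rel B r p)\<^sup>* \<longrightarrow> (a, m) \<in> (parent_rel B r p)\<^sup>* \<longrightarrow> a \<in> T)"
proof -
  let ?P = "parent_rel B r p"
  have edges: "\<And>e. e \<in> E \<Longrightarrow> \<exists>t\<in>B - {r}. e = {t, p t}" and inj: "inj_on rk B"
    and pB: "\<And>t. t \<in> B - {r} \<Longrightarrow> p t \<in> B \<and> rk (p t) < rk t"
    using rt EB unfolding rooted_def by auto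
  have "T \<noteq> {}" using T(2) unfolding connected_graph_def by auto
  then obtain m where m: "m \<in> T" "\<And>t. t \<in> T \<Longrightarrow> rk m \<le> rk t"
    using ex_has_least_nat[of "\<lambda>t. t \<in> T" _ rk] by blast
  have up: "t \<noteq> r \<and> p t \<in> T" if t: "t \<in> T" "t \<noteq> m" for t
  proof (rule ccontr)
    assume no: "\<not> (t \<noteq> r \<and> p t \<in> T)"
    have "(y, t) \<in> ?P\<^sup>*" if "(t, y) \<in> (adj_in E T)\<^sup>*" for y
      using that
    proof (induction rule: rtrancl_induct)
      case (step y z)
      then obtain q where q: "q \<in> B - {r}" "{y, z} = {q, p q}" using edges by blast
      from q(2) consider "y = q" "z = p q" | "z = q" "y = p q" by (auto simp: doubleton_eq_iff)
      then show ?case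
      proof cases
        case 1
        show ?thesis
        proof (cases "y = t")
          case True then show ?thesis using no 1 q step(2) by auto
        next
          case False
          then obtain y' where "(y, y') \<in> ?P" "(y', t) \<in> ?P\<^sup>*"
            using step.IH by (meson converse_rtranclE)
          then show ?thesis using 1 unfolding parent_rel_def by auto
        qed
      next
        case 2
        then have "(z, y) \<in> ?P" using q unfolding parent_rel_def by auto
        then show ?thesis using step.IH by (meson converse_rtrancl_into_rtrancl)
      qed
    qed simp
    then have "(m, t) \<in> ?P\<^sup>*" using connected_graphD[OF T(2) t(1) m(1)] by blast
    then have "rk t \<le> rk m" by (rule rooted_rank_le[OF rt])
    then have "rk t = rk m" using m(2)[OF t(1)] by simp
    then show False using inj t m(1) T(1) by (metis inj_onD subsetD)
  qed
  have anc: "(t, m) \<in> ?P\<^sup>*" if "t \<in> T" for t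
    using that
  proof (induction "rk t" arbitrary: t rule: less_induct)
    case less
    show ?case
    proof (cases "t = m")
      case False
      then have pt: "t \<in> B - {r}" "p t \<in> T" using up[OF less(2)] less(2) T(1) by auto
      then have "(t, p t) \<in> ?P" "rk (p t) < rk t" using pB unfolding parent_rel_def by auto
      then show ?thesis using less(1)[of "p t"] pt by (meson converse_rtrancl_into_rtrancl)
    qed simp
  qed
  \<comment> \<open>Climbing from \<open>t\<close> to \<open>m\<close> stays in \<open>T\<close>,
    since only \<open>m\<close> may have its parent outside. The climb cannot pass \<open>m\<close>,
    because ranks above \<open>m\<close> are strictly smaller.\<close>
  have "a \<in> T" if "(t, a) \<in> ?P\<^sup>*" "(a, m) \<in> ?P\<^sup>*" "t \<in> T" for t a
    using that
  proof (induction rule: rtrancl_induct)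
    case (step y z)
    have "(y, m) \<in> ?P\<^sup>*" using step by (meson converse_rtrancl_into_rtrancl)
    then have y: "y \<in> T" using step by auto
    have yz: "z = p y" "y \<in> B - {r}" using step(2) unfolding parent_rel_def by auto
    have "y \<noteq> m" using rooted_rank_le[OF rt step.prems(1)] pB[OF yz(2)] yz(1) by auto
    then show ?case using up[OF y] yz by simp
  qed
  then show ?thesis using anc m(1) by blast
qed

section \<open>From a tree decomposition to an elimination order\<close>

lemma clique_coverable_subset:
  assumes "clique_coverable V E k B" "A \<subseteq> B"
  shows "clique_coverable V E k A"
proof -
  obtain C where C: "finite C" "card C \<le> k" "\<forall>K\<in>C. clique V E K" "\<Union>C = B"
    using assms(1) unfolding clique_coverable_def by blast
  have "\<forall>K\<in>(\<lambda>K. K \<inter> A) ` C. clique V E K" using C(3) unfolding clique_def by auto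
  moreover have "\<Union>((\<lambda>K. K \<inter> A) ` C) = A" using C(4) assms(2) by auto
  moreover have "card ((\<lambda>K. K \<inter> A) ` C) \<le> k" using card_image_le[OF C(1)] C(2) order_trans by blast
  ultimately show ?thesis using C(1) unfolding clique_coverable_def by (metis finite_imageI)
qed

lemma eliminable_of_tree_decomposition:
  assumes sg: "simple_graph V E" and td: "tree_decomposition V E VT ET X"
    and cov: "\<And>t. t \<in> VT \<Longrightarrow> clique_coverable V E k (X t)"
  shows "eliminable V E k V"
proof -
  have fin: "finite V" and EV: "\<And>e. e \<in> E \<Longrightarrow> e \<subseteq> V" using sg unfolding simple_graph_def by auto
  have tr: "tree VT ET" and eb: "\<And>e. e \<in> E \<Longrightarrow> \<exists>t\<in>VT. e \<subseteq> X t"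
    and cn: "\<And>v. v \<in> V \<Longrightarrow> connected_graph ET {t\<in>VT. v \<in> X t}"
    using td unfolding tree_decomposition_def by auto
  obtain r p rk where rt: "rooted ET VT r p rk" using tree_imp_rooted[OF tr] by blast
  have EB: "\<And>e. e \<in> ET \<Longrightarrow> e \<subseteq> VT" using tr unfolding tree_def simple_graph_def by auto
  have inj: "inj_on rk VT" using rt unfolding rooted_def by auto
  let ?P = "parent_rel VT r p"
  define N where "N v = {t\<in>VT. v \<in> X t}" for v
  have "\<forall>v\<in>V. \<exists>m\<in>N v. \<forall>t\<in>N v. (t, m) \<in> ?P\<^sup>* \<and>
    (\<forall>a. (t, a) \<in> ?P\<^sup>* \<longrightarrow> (a, m) \<in> ?P\<^sup>* \<longrightarrow> a \<in> N v)"
    using rooted_connected_top[OF rt EB _ cn] unfolding N_def by (metis (no_types, lifting) mem_Collect_eq subsetI)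
  then obtain top where top: "\<And>v. v \<in> V \<Longrightarrow> top v \<in> N v"
    "\<And>v t. v \<in> V \<Longrightarrow> t \<in> N v \<Longrightarrow> (t, top v) \<in> ?P\<^sup>*"
    "\<And>v t a. v \<in> V \<Longrightarrow> t \<in> N v \<Longrightarrow> (t, a) \<in> ?P\<^sup>* \<Longrightarrow> (a, top v) \<in> ?P\<^sup>* \<Longrightarrow> a \<in> N v"
    by metis
  have sv: "single_valued ?P" unfolding single_valued_def parent_rel_def by auto
  \<comment> \<open>Parents are unique, so the ancestors of one node form a chain.\<close>
  have chain: "(a, b) \<in> ?P\<^sup>* \<or> (b, a) \<in> ?P\<^sup>*" if "(d, a) \<in> ?P\<^sup>*" "(d, b) \<in> ?P\<^sup>*" for a b d
    using single_valued_confluent[OF sv] that by blast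
  have same: "a = b" if "(a, b) \<in> ?P\<^sup>*" "rk a \<le> rk b" "a \<in> VT" "b \<in> VT" for a b
    using rooted_rank_le[OF rt that(1)] that inj by (metis inj_onD le_antisym)
  have NVT: "N v \<subseteq> VT" for v unfolding N_def by auto
  \<comment> \<open>Vertices are taken by descending rank of their top node. Equal ranks mean equal
    top nodes, so the order among them is immaterial.\<close>
  have "\<exists>S\<subseteq>V. card S = j \<and> eliminable V E k S \<and> (\<forall>u\<in>S. \<forall>w\<in>V - S. rk (top w) \<le> rk (top u))"
    if "j \<le> card V" for j
    using that
  proof (induction j)
    case 0 show ?case by (intro exI[of _ "{}"]) (auto intro: eliminable.empty)
  next
    case (Suc j)
    then obtain S where S: "S \<subseteq> V" "card S = j" "eliminable V E k S"
      "\<And>u w. u \<in> S \<Longrightarrow> w \<in> V - S \<Longrightarrow> rk (top w) \<le> rk (top u)" by auto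
    have finS: "finite S" using S(1) fin finite_subset by blast
    let ?A = "(rk \<circ> top) ` (V - S)"
    have "V - S \<noteq> {}" using S Suc.prems by auto
    then have "Max ?A \<in> ?A" using fin by (intro Max_in) auto
    then obtain v where v: "v \<in> V - S" "rk (top v) = Max ?A" by auto
    have v_max: "rk (top w) \<le> rk (top v)" if "w \<in> V - S" for w
      unfolding v(2) using fin that by (intro Max_ge) auto
    let ?S = "insert v S" and ?t = "top v"
    \<comment> \<open>The top node of \<open>x\<close> has rank at least that of \<open>?t\<close>.
      If some bag of \<open>x\<close> is below \<open>?t\<close>, the two are comparable, so the top
      node of \<open>x\<close>, and with it every node of \<open>x\<close>, is below
      \<open>?t\<close>.\<close>
    have desc: "N x \<subseteq> {a. (a, ?t) \<in> ?P\<^sup>*}"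
      if x: "x \<in> ?S" and d: "d \<in> N x" "(d, ?t) \<in> ?P\<^sup>*" for x d
    proof -
      have xV: "x \<in> V" using x S(1) v(1) by auto
      have ge: "rk ?t \<le> rk (top x)" using x S(4)[of x v] v(1) by auto
      have "(?t, top x) \<in> ?P\<^sup>* \<or> (top x, ?t) \<in> ?P\<^sup>*" using chain[OF d(2) top(2)[OF xV d(1)]] .
      then have "(top x, ?t) \<in> ?P\<^sup>*"
        using same[of ?t "top x"] ge top(1)[OF xV] top(1)[of v] v(1) NVT by fastforce
      then show ?thesis using top(2)[OF xV] by (blast intro: rtrancl_trans)
    qed
    \<comment> \<open>Each edge lies in a common bag, and all bags of its eliminated source are
      below \<open>?t\<close>; hence the walk keeps meeting bags below \<open>?t\<close>.\<close>
    have reach: "x \<in> V \<and> (\<exists>d\<in>N x. (d, ?t) \<in> ?P\<^sup>*)" if "(v, x) \<in> (out_edges E ?S)\<^sup>*" for x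
      using that
    proof (induction rule: rtrancl_induct)
      case base show ?case using v(1) top(1)[of v] by auto
    next
      case (step x y)
      then have xy: "x \<in> ?S" "{x, y} \<in> E" unfolding out_edges_def by auto
      obtain d where "d \<in> N x" "(d, ?t) \<in> ?P\<^sup>*" using step.IH by auto
      from desc[OF xy(1) this] have sub: "N x \<subseteq> {a. (a, ?t) \<in> ?P\<^sup>*}" .
      obtain a where "a \<in> VT" "{x, y} \<subseteq> X a" using eb[OF xy(2)] by auto
      then have "a \<in> N x" "a \<in> N y" unfolding N_def by auto
      then show ?case using sub EV[OF xy(2)] by auto
    qed
    \<comment> \<open>A \<open>w\<close> outside \<open>S\<close> that is reached has a bag below
      \<open>?t\<close>, but its top node is at or above \<open>?t\<close>. As its nodes are
      connected, \<open>?t\<close> is among them.\<close>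
    have "elim_bag E ?S v \<subseteq> X ?t"
    proof
      fix w assume "w \<in> elim_bag E ?S v"
      then have w: "(v, w) \<in> (out_edges E ?S)\<^sup>*" "w \<notin> S" using v(1) unfolding elim_bag_def by auto
      from reach[OF w(1)] obtain d where wV: "w \<in> V" and d: "d \<in> N w" "(d, ?t) \<in> ?P\<^sup>*" by auto
      have le: "rk (top w) \<le> rk ?t" using v_max wV w(2) by auto
      have "(?t, top w) \<in> ?P\<^sup>* \<or> (top w, ?t) \<in> ?P\<^sup>*" using chain[OF d(2) top(2)[OF wV d(1)]] .
      then have "(?t, top w) \<in> ?P\<^sup>*"
        using same[of "top w" ?t] le top(1)[OF wV] top(1)[of v] v(1) NVT by fastforce
      then have "?t \<in> N w" using top(3)[OF wV d(1) d(2)] by blast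
      then show "w \<in> X ?t" unfolding N_def by auto
    qed
    then have "clique_coverable V E k (elim_bag E ?S v)"
      using clique_coverable_subset cov top(1)[of v] v(1) NVT by blast
    moreover have "?S - {v} = S" using v(1) by auto
    ultimately have "eliminable V E k ?S" using eliminable.step[of v ?S V E k] v(1) S(3) by simp
    then show ?case using S v(1) v_max finS by (intro exI[of _ ?S]) auto
  qed
  then show ?thesis using card_subset_eq[OF fin] by (metis le_refl)
qed

section \<open>From an elimination order to a tree decomposition\<close>

lemma eliminable_imp_list:
  assumes "eliminable V E k S"
  shows "\<exists>vs. distinct vs \<and> set vs = S \<and> S \<subseteq> V \<and>
    (\<forall>i<length vs. clique_coverable V E k (elim_bag E (set (take (Suc i) vs)) (vs ! i)))"
  using assms
proof (induction rule: eliminable.induct)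
  case (step v S)
  then obtain vs where vs: "distinct vs" "set vs = S - {v}" "S - {v} \<subseteq> V"
    "\<forall>i<length vs. clique_coverable V E k (elim_bag E (set (take (Suc i) vs)) (vs ! i))" by blast
  have S: "S = insert v (set vs)" using vs(2) step by auto
  have "\<forall>i<length (vs @ [v]). clique_coverable V E k
      (elim_bag E (set (take (Suc i) (vs @ [v]))) ((vs @ [v]) ! i))"
    using vs(4) step S by (auto simp: less_Suc_eq nth_append)
  then show ?case using vs step by (intro exI[of _ "vs @ [v]"]) auto
qed auto

text \<open>On the reversed walk the sources are the inner vertices, which lie in \<open>S\<close>
  already, and \<open>u\<close>, which has to be added.\<close>

lemma out_edges_rev:
  assumes "(v, u) \<in> (out_edges E S)\<^sup>*"
  shows "(u, v) \<in> (out_edges E (insert u S))\<^sup>*"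
  using assms
proof (induction rule: rtrancl_induct)
  case (step y z)
  have "y \<in> S" and yz: "{y, z} \<in> E" using step(2) unfolding out_edges_def by auto
  then have "(out_edges E (insert y S))\<^sup>* \<subseteq> (out_edges E (insert z S))\<^sup>*"
    by (intro rtrancl_mono) (auto simp: out_edges_def)
  moreover have "(z, y) \<in> out_edges E (insert z S)" using yz unfolding out_edges_def by (auto simp: insert_commute)
  ultimately show ?case using step.IH by (meson converse_rtrancl_into_rtrancl subsetD)
qed simp

text \<open>Both neighbours of the smallest number on a cycle are larger, so each of them is its
  parent; but the two neighbours on a cycle are distinct.\<close>

lemma acyclic_of_increasing_parent:
  fixes p :: "nat \<Rightarrow> nat"
  assumes inc: "\<And>i. i \<in> I \<Longrightarrow> i < p i"
  shows "\<not> cycle {{i, p i} | i. i \<in> I} q"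
proof
  let ?l = "length q"
  assume c: "cycle {{i, p i} | i. i \<in> I} q"
  then have l: "3 \<le> ?l" and d: "distinct q"
    and e: "\<And>i. i < ?l \<Longrightarrow> \<exists>j\<in>I. {q ! i, q ! (Suc i mod ?l)} = {j, p j}"
    unfolding cycle_def by auto
  obtain a where a: "a < ?l" "\<And>b. b < ?l \<Longrightarrow> q ! a \<le> q ! b"
    using ex_has_least_nat[of "\<lambda>a. a < ?l" 0 "\<lambda>a. q ! a"] l by (metis less_le_trans zero_less_numeral)
  have par: "y = p (q ! a)" if "{q ! a, y} = {j, p j}" "j \<in> I" "q ! a \<le> y" for y j
    using inc[OF that(2)] that(1,3) by (auto simp: doubleton_eq_iff)
  \<comment> \<open>Positions of the cyclic predecessor and successor of the minimum.\<close>
  let ?b = "if a = 0 then ?l - 1 else a - 1" and ?c = "Suc a mod ?l"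
  have b: "?b < ?l" "Suc ?b mod ?l = a" using a(1) by auto
  have cl: "?c < ?l" using l by (intro mod_less_divisor) linarith
  obtain j where "j \<in> I" "{q ! a, q ! ?c} = {j, p j}" using e[OF a(1)] by auto
  then have 1: "q ! ?c = p (q ! a)" using par a(2)[OF cl] by blast
  obtain j where "j \<in> I" "{q ! ?b, q ! a} = {j, p j}" using e[OF b(1)] b(2) by auto
  then have 2: "q ! ?b = p (q ! a)" using par a(2)[OF b(1)] by (metis insert_commute)
  have "?b = ?c"
    using nth_eq_iff_index_eq[OF d b(1) cl] trans[OF 2 1[symmetric]] by (rule iffD1)
  then show False using l a(1) by (auto split: if_splits simp: mod_Suc)
qed

lemma tree_decomposition_of_eliminable:
  fixes V :: "'a set"
  assumes sg: "simple_graph V E" and el: "eliminable V E k V"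
  shows "\<exists>(VT :: nat set) ET X. tree_decomposition V E VT ET X \<and>
    (\<forall>t\<in>VT. clique_coverable V E k (X t))"
proof (cases "V = {}")
  case True
  have "E = {}" using sg True unfolding simple_graph_def by auto
  \<comment> \<open>A tree has at least one node, so the empty graph gets one node with an empty
    bag.\<close>
  moreover have "tree {0::nat} {}"
    unfolding tree_def simple_graph_def cycle_def
    by (auto intro: connected_graphI[of 0] intro!: exI[of _ "0::nat"])
  ultimately have "tree_decomposition V E {0::nat} {} (\<lambda>_. {})" using True
    unfolding tree_decomposition_def by auto
  moreover have "clique_coverable V E k {}" unfolding clique_coverable_def
    by (intro exI[of _ "{}"]) auto
  ultimately show ?thesis by (metis singletonD)
next
  case False
  obtain vs where vs: "distinct vs" "set vs = V"
    "\<And>i. i < length vs \<Longrightarrow> clique_coverable V E k (elim_bag E (set (take (Suc i) vs)) (vs ! i))"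
    using eliminable_imp_list[OF el] by blast
  define m where "m = length vs"
  define S where "S i = set (take (Suc i) vs)" for i
  define B where "B i = elim_bag E (S i) (vs ! i)" for i
  \<comment> \<open>The default \<open>Suc i\<close> serves bags without a later member: it links
    the parts of the decomposition belonging to different components of the graph into one
    tree.\<close>
  define p where "p i = (if \<exists>j. i < j \<and> j < m \<and> vs ! j \<in> B i
    then LEAST j. i < j \<and> j < m \<and> vs ! j \<in> B i else Suc i)" for i
  define ET where "ET = {{i, p i} | i. i \<in> {i. Suc i < m}}"
  have EV: "\<And>e. e \<in> E \<Longrightarrow> e \<subseteq> V \<and> card e = 2" using sg unfolding simple_graph_def by auto
  have m0: "0 < m" using False vs(2) unfolding m_def by auto
  have inS: "vs ! j \<in> S i \<longleftrightarrow> j \<le> i" if "j < m" "i < m" for i j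
  proof
    assume "vs ! j \<in> S i"
    then obtain l where "l < length (take (Suc i) vs)" "take (Suc i) vs ! l = vs ! j"
      unfolding S_def by (metis in_set_conv_nth)
    then have "l \<le> i" "l < m" "vs ! l = vs ! j" using m_def by auto
    then show "j \<le> i" using vs(1) that unfolding m_def by (metis nth_eq_iff_index_eq)
  next
    assume "j \<le> i"
    then have "take (Suc i) vs ! j = vs ! j" "j < length (take (Suc i) vs)" using that m_def by auto
    then show "vs ! j \<in> S i" unfolding S_def by (metis nth_mem)
  qed
  have p: "i < p i \<and> p i < m" if "Suc i < m" for i
  proof (cases "\<exists>j. i < j \<and> j < m \<and> vs ! j \<in> B i")
    case True
    from LeastI_ex[OF this] show ?thesis using True unfolding p_def by auto
  next
    case False then show ?thesis using that unfolding p_def by auto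
  qed
  have BV: "B i \<subseteq> V" if "i < m" for i
  proof
    fix w assume "w \<in> B i"
    then have "(vs ! i, w) \<in> (out_edges E (S i))\<^sup>*" unfolding B_def elim_bag_def by auto
    then show "w \<in> V"
    proof (induction rule: rtrancl_induct)
      case base show ?case using that vs(2) m_def by auto
    next
      case (step y z) then show ?case using EV unfolding out_edges_def by auto
    qed
  qed
  have selfB: "vs ! i \<in> B i" for i unfolding B_def elim_bag_def by auto
  have tree: "tree {..<m} ET"
    unfolding tree_def
  proof (intro conjI)
    show "simple_graph {..<m} ET"
      unfolding simple_graph_def
    proof (intro conjI ballI)
      fix e assume "e \<in> ET"
      then obtain i where i: "e = {i, p i}" "Suc i < m" unfolding ET_def by auto
      show "e \<subseteq> {..<m}" "card e = 2" using p[OF i(2)] i by auto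
    qed simp
    show "connected_graph ET {..<m}"
    proof (rule connected_graphI[of "m - 1"])
      fix u assume "u \<in> {..<m}"
      then show "(u, m - 1) \<in> (adj_in ET {..<m})\<^sup>*"
      proof (induction "m - u" arbitrary: u rule: less_induct)
        case less
        show ?case
        proof (cases "Suc u < m")
          case True
          have "(u, p u) \<in> adj_in ET {..<m}" using p[OF True] True unfolding ET_def by auto
          moreover have "(p u, m - 1) \<in> (adj_in ET {..<m})\<^sup>*" 
            using less(1)[of "p u"] p[OF True] True by auto
          ultimately show ?thesis by (meson converse_rtrancl_into_rtrancl)
        next
          case False then have "u = m - 1" using less(2) by auto
          then show ?thesis by simp
        qed
      qed
    qed (use m0 in auto)
    show "\<nexists>q. cycle ET q" using acyclic_of_increasing_parent[of "{i. Suc i < m}" p] p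
      unfolding ET_def by blast
  qed
  have "tree_decomposition V E {..<m} ET B"
    unfolding tree_decomposition_def
  proof (intro conjI ballI)
    show "tree {..<m} ET" by (rule tree)
    show "B t \<subseteq> V" if "t \<in> {..<m}" for t using BV that by auto
    show "\<exists>t\<in>{..<m}. v \<in> B t" if "v \<in> V" for v
      using that vs(2) selfB unfolding m_def by (metis in_set_conv_nth lessThan_iff)
  next
    fix e assume e: "e \<in> E"
    then obtain x y where xy: "e = {x, y}" "x \<noteq> y" using EV by (meson card_2_iff)
    have "\<exists>i<m. x = vs ! i" "\<exists>i<m. y = vs ! i"
      using xy EV[OF e] vs(2) unfolding m_def by (metis in_set_conv_nth insertCI subsetD)+
    then obtain i j where ij: "i < j" "j < m" "e = {vs ! i, vs ! j}"
      using xy by (metis insert_commute linorder_neq_iff)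
    have "vs ! j \<notin> S i" "vs ! i \<in> S i" using inS ij by auto
    then have "vs ! j \<in> B i" using ij e unfolding B_def elim_bag_def out_edges_def by auto
    then show "\<exists>t\<in>{..<m}. e \<subseteq> B t" using ij selfB by (intro bexI[of _ i]) auto
  next
    fix w assume "w \<in> V"
    then obtain j where j: "j < m" "w = vs ! j" using vs(2) unfolding m_def by (metis in_set_conv_nth)
    let ?T = "{t \<in> {..<m}. w \<in> B t}"
    show "connected_graph ET ?T"
    proof (rule connected_graphI[of j])
      show "j \<in> ?T" using j selfB by auto
      fix i assume "i \<in> ?T"
      then show "(i, j) \<in> (adj_in ET ?T)\<^sup>*"
      proof (induction "m - i" arbitrary: i rule: less_induct)
        case less
        then have i: "i < m" "w \<in> B i" by auto
        \<comment> \<open>For \<open>i\<close> beyond \<open>j\<close> the vertex \<open>w\<close>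
          has been eliminated, and only its own bag retains an eliminated vertex.\<close>
        have "i \<le> j"
        proof (rule ccontr)
          assume "\<not> i \<le> j"
          then have "vs ! j \<in> S i" "vs ! j \<noteq> vs ! i" using inS[OF j(1) i(1)] vs(1) i j unfolding m_def
            by (auto simp: nth_eq_iff_index_eq)
          then show False using i(2) j(2) unfolding B_def elim_bag_def by auto
        qed
        show ?case
        proof (cases "i = j")
          case False
          then have ij: "i < j" using \<open>i \<le> j\<close> by simp
          let ?Q = "\<lambda>j. i < j \<and> j < m \<and> vs ! j \<in> B i"
          have Qj: "?Q j" using ij j i by auto
          then have pi: "p i = Least ?Q" unfolding p_def by auto
          have Qp: "?Q (p i)" unfolding pi using LeastI[of ?Q j] Qj by blast
          have le: "p i \<le> j" unfolding pi using Least_le[of ?Q j] Qj by blast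
          have "w \<in> B (p i)"
          proof (cases "p i = j")
            case True then show ?thesis using selfB j by auto
          next
            case False
            then have lt: "p i < j" using le by simp
            let ?u = "vs ! p i"
            \<comment> \<open>Through \<open>S i\<close>, \<open>vs ! i\<close> reaches both
              \<open>?u\<close> and \<open>w\<close>. Walking from \<open>?u\<close> back to
              \<open>vs ! i\<close> and on to \<open>w\<close> uses only sources in
              \<open>S (p i)\<close>, and \<open>w\<close> is not yet eliminated there.\<close>
            have "(vs ! i, ?u) \<in> (out_edges E (S i))\<^sup>*" "(vs ! i, w) \<in> (out_edges E (S i))\<^sup>*"
              using Qp i(2) unfolding B_def elim_bag_def by auto
            moreover have sub: "insert ?u (S i) \<subseteq> S (p i)"
              using inS[of "p i" "p i"] Qp set_take_subset_set_take[of "Suc i" "Suc (p i)" vs] unfolding S_def by auto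
            ultimately have "(?u, w) \<in> (out_edges E (S (p i)))\<^sup>*"
              using out_edges_rev[of "vs ! i" ?u E "S i"]
                rtrancl_mono[of "out_edges E (insert ?u (S i))" "out_edges E (S (p i))"]
                rtrancl_mono[of "out_edges E (S i)" "out_edges E (S (p i))"]
              by (smt (verit, ccfv_SIG) case_prodE case_prodI insert_subset mem_Collect_eq out_edges_def rtrancl_trans subset_iff)
            moreover have "w \<notin> S (p i)" using inS[of j "p i"] j lt by auto
            ultimately show ?thesis unfolding B_def elim_bag_def by auto
          qed
          then have "(i, p i) \<in> adj_in ET ?T" and "p i \<in> ?T"
            using i Qp ij j unfolding ET_def by auto
          moreover have "(p i, j) \<in> (adj_in ET ?T)\<^sup>*" using less(1)[of "p i"] \<open>p i \<in> ?T\<close> Qp i by auto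
          ultimately show ?thesis by (meson converse_rtrancl_into_rtrancl)
        qed simp
      qed
    qed
  qed
  moreover have "\<forall>t\<in>{..<m}. clique_coverable V E k (B t)" using vs(3) unfolding B_def S_def m_def by auto
  ultimately show ?thesis by blast
qed

section \<open>Tree-clique width as the least \<open>k\<close> that permits elimination\<close>

lemma clique_coverable_card:
  assumes "finite V" "B \<subseteq> V"
  shows "clique_coverable V E (card V) B"
proof -
  have "finite B" using assms finite_subset by blast
  moreover have "card ((\<lambda>v. {v}) ` B) \<le> card V"
    using card_image_le[OF \<open>finite B\<close>] card_mono[OF assms] order_trans by blast
  ultimately show ?thesis unfolding clique_coverable_def clique_def using assms(2)
    by (intro exI[of _ "(\<lambda>v. {v}) ` B"]) auto
qed

lemma eliminable_iff_width:
  fixes V :: "'a set"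
  assumes sg: "simple_graph V E"
  shows "eliminable V E k V \<longleftrightarrow> (\<exists>(VT :: nat set) ET X C.
    augmented_tree_decomposition V E VT ET X C \<and> width VT C \<le> k)"
proof
  assume "eliminable V E k V"
  then obtain VT :: "nat set" and ET X where td: "tree_decomposition V E VT ET X"
    and cov: "\<forall>t\<in>VT. clique_coverable V E k (X t)"
    using tree_decomposition_of_eliminable[OF sg] by blast
  then obtain C where C: "\<And>t. t \<in> VT \<Longrightarrow> card (C t) \<le> k \<and> (\<forall>K\<in>C t. clique V E K) \<and> \<Union>(C t) = X t"
    unfolding clique_coverable_def by metis
  have "finite VT" "VT \<noteq> {}" using td unfolding tree_decomposition_def tree_def simple_graph_def connected_graph_def by auto
  then have "width VT C \<le> k" using C unfolding width_def by auto
  moreover have "augmented_tree_decomposition V E VT ET X C" using td C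
    unfolding augmented_tree_decomposition_def by auto
  ultimately show "\<exists>(VT :: nat set) ET X C. augmented_tree_decomposition V E VT ET X C \<and> width VT C \<le> k"
    by blast
next
  assume "\<exists>(VT :: nat set) ET X C. augmented_tree_decomposition V E VT ET X C \<and> width VT C \<le> k"
  then obtain VT :: "nat set" and ET X C where td: "tree_decomposition V E VT ET X"
    and C': "\<forall>t\<in>VT. (\<forall>K\<in>C t. clique V E K) \<and> \<Union>(C t) = X t" and w: "width VT C \<le> k"
    unfolding augmented_tree_decomposition_def by blast
  note C = bspec[OF C']
  have fin: "finite VT" using td unfolding tree_decomposition_def tree_def simple_graph_def by auto
  have "clique_coverable V E k (X t)" if t: "t \<in> VT" for t
  proof -
    \<comment> \<open>An infinite family would have \<open>card\<close> 0 and hide its size; cliques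
      of a finite graph exclude this.\<close>
    have "C t \<subseteq> Pow V" using C[OF t] unfolding clique_def by auto
    then have "finite (C t)" using sg unfolding simple_graph_def by (meson finite_Pow_iff finite_subset)
    moreover have "card (C t) \<le> width VT C" unfolding width_def using fin t by (intro Max_ge) auto
    ultimately show ?thesis using C[OF t] w unfolding clique_coverable_def by (meson order_trans)
  qed
  then show "eliminable V E k V" using eliminable_of_tree_decomposition[OF sg td] by blast
qed

lemma elim_bag_subset:
  assumes "simple_graph V E" "v \<in> V"
  shows "elim_bag E S v \<subseteq> V"
proof
  fix w assume "w \<in> elim_bag E S v"
  then have "(v, w) \<in> (out_edges E S)\<^sup>*" unfolding elim_bag_def by auto
  then show "w \<in> V"
    by (induction rule: rtrancl_induct) (use assms in \<open>auto simp: out_edges_def simple_graph_def\<close>)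
qed

lemma eliminable_card:
  assumes "simple_graph V E"
  shows "eliminable V E (card V) V"
proof -
  have fin: "finite V" using assms unfolding simple_graph_def by auto
  have "eliminable V E (card V) S" if "finite S" "S \<subseteq> V" for S
    using that
  proof (induction rule: finite_induct)
    case (insert v S)
    then have v: "v \<in> V" and el: "eliminable V E (card V) (insert v S - {v})" by auto
    show ?case
      by (rule eliminable.step[OF insertI1 v el clique_coverable_card[OF fin elim_bag_subset[OF assms v]]])
  qed (rule eliminable.empty)
  then show ?thesis using fin by blast
qed

text \<open>\<open>tcl\<close> is a \<open>LEAST\<close>, so a decomposition must exist before its
  value says anything; covering by singletons supplies one.\<close>

lemma tcl_le_iff:
  assumes sg: "simple_graph V E"
  shows "tcl V E \<le> k \<longleftrightarrow> eliminable V E k V"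
proof -
  define W where "W k \<longleftrightarrow> (\<exists>(VT :: nat set) ET X C.
    augmented_tree_decomposition V E VT ET X C \<and> width VT C = k)" for k
  have tcl: "tcl V E = (LEAST k. W k)" unfolding tcl_def W_def ..
  have iff: "eliminable V E k V \<longleftrightarrow> (\<exists>l\<le>k. W l)" for k
  proof -
    have "\<exists>l\<le>k. W l"
      if "augmented_tree_decomposition V E VT ET X C" "width VT C \<le> k" for VT :: "nat set" and ET X C
      using that unfolding W_def by fast
    then show ?thesis unfolding eliminable_iff_width[OF sg] W_def by fast
  qed
  show ?thesis
  proof
    obtain l where "W l" using eliminable_card[OF sg] iff by blast
    then have "W (tcl V E)" unfolding tcl by (rule LeastI)
    then show "eliminable V E k V" if "tcl V E \<le> k" using that iff by blast
  next
    assume "eliminable V E k V"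
    then obtain l where "W l" "l \<le> k" using iff by blast
    then show "tcl V E \<le> k" unfolding tcl by (meson Least_le order_trans)
  qed
qed


section \<open>Resource bounds of programs\<close>

text \<open>A constant weighs as much as its value, so one number bounds both the size of an
  expression and the bit lengths of its constants.\<close>

fun expr_weight :: "aexp \<Rightarrow> nat" where
  "expr_weight (Const k) = 1 + k"
| "expr_weight (Cell x e) = 1 + expr_weight e"
| "expr_weight (Bop f e1 e2) = 1 + expr_weight e1 + expr_weight e2"

fun iterations :: "state \<Rightarrow> aexp \<Rightarrow> nat" where
  "iterations s0 (Bop f e1 e2) = aval e2 s0"
| "iterations s0 _ = 0"

text \<open>Running time in units of a squared word length. The number of iterations of a loop
  \<open>while i < e\<close> is read off the nominal state \<open>s0\<close>, in which \<open>e\<close> has the right value.\<close>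

fun units :: "state \<Rightarrow> com \<Rightarrow> nat" where
  "units s0 Skip = 1"
| "units s0 (Store x e1 e2) = 3 + (expr_weight e1)\<^sup>2 + (expr_weight e2)\<^sup>2"
| "units s0 (Seq c1 c2) = units s0 c1 + units s0 c2"
| "units s0 (Cond e c1 c2) = 1 + (expr_weight e)\<^sup>2 + units s0 c1 + units s0 c2"
| "units s0 (While e c) =
     1 + (expr_weight e)\<^sup>2 + iterations s0 e * (1 + (expr_weight e)\<^sup>2 + units s0 c)"

definition For :: "nat \<Rightarrow> aexp \<Rightarrow> com \<Rightarrow> com" where
  "For x e c = Seq (Store x (Const 0) (Const 0))
     (While (Bop Less (Cell x (Const 0)) e)
       (Seq c (Store x (Const 0) (Bop Plus (Cell x (Const 0)) (Const 1)))))"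

section \<open>Bit lengths, expression costs and state sizes\<close>

lemma len_le_iff: "len v \<le> w \<longleftrightarrow> v < 2 ^ w"
  by (simp add: floorlog_le_iff)

lemma less_two_power_len: "v < 2 ^ len v"
  using len_le_iff by blast

lemma len_le_self: "len v \<le> v"
  by (simp add: len_le_iff)

lemma len_mono: "a \<le> b \<Longrightarrow> len a \<le> len b"
  by (rule floorlog_mono)

lemma len_bop_le: "len (bop_val f a b) \<le> len a + len b + 1"
proof (cases f)
  case Plus
  have "a + b < 2 ^ len a + 2 ^ len b" using less_two_power_len[of a] less_two_power_len[of b] by linarith
  also have "\<dots> \<le> 2 ^ (len a + len b) + 2 ^ (len a + len b)"
    by (intro add_mono power_increasing) auto
  finally show ?thesis using Plus by (simp add: len_le_iff)
next
  case Minus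
  then show ?thesis using len_mono[of "a - b" a] by simp
next
  case Times
  have "a * b < 2 ^ len a * 2 ^ len b" using less_two_power_len[of a] less_two_power_len[of b]
    by (intro mult_strict_mono) auto
  then have "len (a * b) \<le> len a + len b" by (simp only: len_le_iff power_add)
  then show ?thesis using Times by simp
next
  case Div
  then show ?thesis using len_mono[of "a div b" a] by simp
next
  case Mod
  then show ?thesis using len_mono[of "a mod b" a] by simp
next
  case BitAnd
  \<comment> \<open>A number is below \<open>2 ^ w\<close> iff truncation to \<open>w\<close> bits
    leaves it unchanged, and truncation commutes with bitwise operations.\<close>
  have "Bit_Operations.and a b = take_bit (len a + len b) (Bit_Operations.and a b)"
    by (subst take_bit_and) (simp add: take_bit_nat_eq_self less_le_trans[OF less_two_power_len power_increasing])
  then have "Bit_Operations.and a b < 2 ^ (len a + len b)" by (metis take_bit_nat_less_exp)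
  then show ?thesis using BitAnd by (simp add: len_le_iff)
next
  case BitOr
  have "Bit_Operations.or a b = take_bit (len a + len b) (Bit_Operations.or a b)"
    by (subst take_bit_or) (simp add: take_bit_nat_eq_self less_le_trans[OF less_two_power_len power_increasing])
  then have "Bit_Operations.or a b < 2 ^ (len a + len b)" by (metis take_bit_nat_less_exp)
  then show ?thesis using BitOr by (simp add: len_le_iff)
next
  case BitXor
  have "Bit_Operations.xor a b = take_bit (len a + len b) (Bit_Operations.xor a b)"
    by (subst take_bit_xor) (simp add: take_bit_nat_eq_self less_le_trans[OF less_two_power_len power_increasing])
  then have "Bit_Operations.xor a b < 2 ^ (len a + len b)" by (metis take_bit_nat_less_exp)
  then show ?thesis using BitXor by (simp add: len_le_iff)
next
  case Less
  then have "len (bop_val f a b) \<le> 1" by (simp only: len_le_iff) simp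
  then show ?thesis by simp
next
  case Equal
  then have "len (bop_val f a b) \<le> 1" by (simp only: len_le_iff) simp
  then show ?thesis by simp
qed

text \<open>The program uses arrays 0 to 14; 16 is a round bound on their names.\<close>

definition small :: "nat \<Rightarrow> nat \<Rightarrow> state \<Rightarrow> bool" where
  "small B L s \<longleftrightarrow> (\<forall>x i. s x i \<noteq> 0 \<longrightarrow> x < 16 \<and> i < B \<and> s x i < 2 ^ L)"

lemma smallD: "small B L s \<Longrightarrow> s x i < 2 ^ L"
  unfolding small_def by (cases "s x i = 0") auto

lemma small_upd:
  "\<lbrakk> small B L s; x < 16; i < B; v < 2 ^ L \<rbrakk> \<Longrightarrow> small B L (s(x := (s x)(i := v)))"
  unfolding small_def by auto

lemma len_aval_le:
  assumes "small B L s"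
  shows "len (aval e s) \<le> expr_weight e * (L + 1)"
proof (induction e)
  case (Const k)
  have "len k \<le> k" by (rule len_le_self)
  then show ?case by (simp add: algebra_simps)
next
  case (Cell x e)
  have "len (s x (aval e s)) \<le> L" using smallD[OF assms] by (simp add: len_le_iff)
  then show ?case by (simp add: algebra_simps)
next
  case (Bop f e1 e2)
  then show ?case using len_bop_le[of f "aval e1 s" "aval e2 s"] by (simp add: algebra_simps)
qed

text \<open>Operators cost the product of the operand lengths, hence the square of the word length.
  Squared weights absorb this product because \<open>(1 + w1 + w2)\<^sup>2\<close> exceeds
  \<open>w1\<^sup>2 + w2\<^sup>2 + (1 + w1) * (1 + w2)\<close>.\<close>

lemma acost_le:
  assumes "small B L s"
  shows "acost e s \<le> (expr_weight e)\<^sup>2 * (L + 1)\<^sup>2"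
proof (induction e)
  case (Const k)
  have "acost (Const k) s \<le> (1 + k) * 1" using len_le_self[of k] by simp
  also have "\<dots> \<le> (1 + k)\<^sup>2 * (L + 1)\<^sup>2"
    by (intro mult_mono) (simp_all add: power2_eq_square)
  finally show ?case by simp
next
  case (Cell x e)
  let ?w = "expr_weight e" and ?K = "L + 1"
  have "acost (Cell x e) s \<le> ?w\<^sup>2 * ?K\<^sup>2 + ?w * ?K + ?K"
    using Cell len_aval_le[OF assms, of e] smallD[OF assms, of x "aval e s"]
    by (simp add: len_le_iff[symmetric])
  also have "\<dots> \<le> ?w\<^sup>2 * ?K\<^sup>2 + ?w * ?K\<^sup>2 + ?K\<^sup>2"
    by (intro add_mono mult_mono) (simp_all add: power2_eq_square)
  also have "\<dots> \<le> (1 + ?w)\<^sup>2 * ?K\<^sup>2"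
    by (simp add: power2_eq_square algebra_simps)
  finally show ?case by simp
next
  case (Bop f e1 e2)
  let ?w1 = "expr_weight e1" and ?w2 = "expr_weight e2" and ?K = "L + 1"
  have "(1 + len (aval e1 s)) * (1 + len (aval e2 s)) \<le> ((1 + ?w1) * ?K) * ((1 + ?w2) * ?K)"
    using len_aval_le[OF assms, of e1] len_aval_le[OF assms, of e2] by (intro mult_mono) auto
  then have "acost (Bop f e1 e2) s \<le> (?w1\<^sup>2 + ?w2\<^sup>2 + (1 + ?w1) * (1 + ?w2)) * ?K\<^sup>2"
    using Bop by (simp add: power2_eq_square algebra_simps)
  also have "\<dots> \<le> (1 + ?w1 + ?w2)\<^sup>2 * ?K\<^sup>2"
    by (intro mult_right_mono) (simp_all add: power2_eq_square algebra_simps)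
  finally show ?case by simp
qed

text \<open>At most \<open>16 * B\<close> cells are charged, and \<open>B \<le> 2 ^ L\<close> makes
  \<open>L\<close> a bound for index lengths as well.\<close>

lemma state_size_le:
  assumes s: "small B L s" and B: "B \<le> 2 ^ L"
  shows "state_size s \<le> 16 * B * (1 + 2 * L)"
proof -
  have sub: "{(x, i). s x i \<noteq> 0} \<subseteq> {..<16} \<times> {..<B}" using s unfolding small_def by auto
  have "state_size s \<le> (\<Sum>(x, i)\<in>{(x, i). s x i \<noteq> 0}. 1 + 2 * L)"
    unfolding state_size_def
  proof (rule sum_mono)
    fix q assume q: "q \<in> {(x, i). s x i \<noteq> 0}"
    obtain x i where xi: "q = (x, i)" by (cases q)
    then have "s x i \<noteq> 0" using q by simp
    then have "i < 2 ^ L" "s x i < 2 ^ L" using s B unfolding small_def by (auto intro: less_le_trans)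
    then have "len i \<le> L" "len (s x i) \<le> L" by (simp_all add: len_le_iff)
    then show "(case q of (x, i) \<Rightarrow> 1 + len i + len (s x i)) \<le> (case q of (x, i) \<Rightarrow> 1 + 2 * L)"
      by (simp add: xi)
  qed
  also have "\<dots> = card {(x, i). s x i \<noteq> 0} * (1 + 2 * L)" by (simp add: case_prod_unfold)
  also have "\<dots> \<le> card ({..<16::nat} \<times> {..<B}) * (1 + 2 * L)"
    by (intro mult_right_mono card_mono[OF _ sub]) auto
  finally show ?thesis by simp
qed

section \<open>Total correctness together with time and space bounds\<close>

locale bounded_ram =
  fixes B L :: nat and s0 :: state
  assumes B_le: "B \<le> 2 ^ L" and B_pos: "0 < B"
begin

text \<open>A weakest precondition with resource bounds built in. Smallness is assumed initially and
  guaranteed finally, so \<open>Q\<close> need not mention it, and a store only has to show that the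
  one cell it writes fits.\<close>

definition run :: "com \<Rightarrow> state \<Rightarrow> (state \<Rightarrow> bool) \<Rightarrow> bool" where
  "run c s Q \<longleftrightarrow> (small B L s \<longrightarrow> (\<exists>t m s'. big_step c s t m s' \<and>
     t \<le> units s0 c * (L + 1)\<^sup>2 \<and> m \<le> 16 * B * (1 + 2 * L) \<and> small B L s' \<and> Q s'))"

lemma one_le: "1 * (L + 1)\<^sup>2 \<ge> 1"
  by simp

lemma run_mono:
  assumes "run c s Q" "\<And>s'. small B L s' \<Longrightarrow> Q s' \<Longrightarrow> Q' s'"
  shows "run c s Q'"
  using assms unfolding run_def by meson

lemma run_Skip: "Q s \<Longrightarrow> run Skip s Q"
  unfolding run_def using big_step.Skip[of s] state_size_le[OF _ B_le, of s]
  by (auto intro!: exI)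

lemma run_Store:
  assumes "x < 16" and bnd: "aval e1 s < B" "aval e2 s < 2 ^ L"
    and Q: "Q (s(x := (s x)(aval e1 s := aval e2 s)))"
  shows "run (Store x e1 e2) s Q"
  unfolding run_def
proof
  assume s: "small B L s"
  let ?s' = "s(x := (s x)(aval e1 s := aval e2 s))"
  have s': "small B L ?s'" using small_upd[OF s assms(1-3)] .
  have "len (aval e1 s) \<le> L" "len (aval e2 s) \<le> L"
    using bnd B_le by (auto simp: len_le_iff)
  then have "1 + acost e1 s + acost e2 s + len (aval e1 s) + len (aval e2 s)
      \<le> 1 + (expr_weight e1)\<^sup>2 * (L + 1)\<^sup>2 + (expr_weight e2)\<^sup>2 * (L + 1)\<^sup>2 + L + L"
    using acost_le[OF s, of e1] acost_le[OF s, of e2] by linarith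
  also have "\<dots> \<le> units s0 (Store x e1 e2) * (L + 1)\<^sup>2"
    by (simp add: power2_eq_square algebra_simps)
  finally show "\<exists>t m s'. big_step (Store x e1 e2) s t m s' \<and>
     t \<le> units s0 (Store x e1 e2) * (L + 1)\<^sup>2 \<and> m \<le> 16 * B * (1 + 2 * L) \<and> small B L s' \<and> Q s'"
    using big_step.Store[OF refl refl refl] state_size_le[OF s B_le] state_size_le[OF s' B_le] s' Q
    by (meson max.bounded_iff)
qed

lemma run_Seq:
  assumes "run c1 s (\<lambda>s'. run c2 s' Q)"
  shows "run (Seq c1 c2) s Q"
  unfolding run_def
proof
  assume "small B L s"
  then obtain t1 m1 s1 where 1: "big_step c1 s t1 m1 s1" "t1 \<le> units s0 c1 * (L + 1)\<^sup>2"
    "m1 \<le> 16 * B * (1 + 2 * L)" "small B L s1" "run c2 s1 Q"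
    using assms unfolding run_def[of c1] by blast
  then obtain t2 m2 s2 where 2: "big_step c2 s1 t2 m2 s2" "t2 \<le> units s0 c2 * (L + 1)\<^sup>2"
    "m2 \<le> 16 * B * (1 + 2 * L)" "small B L s2" "Q s2"
    unfolding run_def by blast
  have "t1 + t2 \<le> units s0 (Seq c1 c2) * (L + 1)\<^sup>2" using 1(2) 2(2) by (simp add: algebra_simps)
  moreover have "max m1 m2 \<le> 16 * B * (1 + 2 * L)" using 1(3) 2(3) by simp
  ultimately show "\<exists>t m s'. big_step (Seq c1 c2) s t m s' \<and>
     t \<le> units s0 (Seq c1 c2) * (L + 1)\<^sup>2 \<and> m \<le> 16 * B * (1 + 2 * L) \<and> small B L s' \<and> Q s'"
    using big_step.Seq[OF 1(1) 2(1)] 2(4,5) by blast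
qed

lemma run_Cond:
  assumes "aval e s \<noteq> 0 \<Longrightarrow> run c1 s Q" "aval e s = 0 \<Longrightarrow> run c2 s Q"
  shows "run (Cond e c1 c2) s Q"
  unfolding run_def
proof
  assume s: "small B L s"
  note cost = acost_le[OF s, of e]
  show "\<exists>t m s'. big_step (Cond e c1 c2) s t m s' \<and>
     t \<le> units s0 (Cond e c1 c2) * (L + 1)\<^sup>2 \<and> m \<le> 16 * B * (1 + 2 * L) \<and> small B L s' \<and> Q s'"
  proof (cases "aval e s = 0")
    case False
    then obtain t m s' where 1: "big_step c1 s t m s'" "t \<le> units s0 c1 * (L + 1)\<^sup>2"
      "m \<le> 16 * B * (1 + 2 * L)" "small B L s'" "Q s'"
      using assms(1) s unfolding run_def by blast
    have "1 + acost e s + t \<le> units s0 (Cond e c1 c2) * (L + 1)\<^sup>2"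
      using 1(2) cost one_le unfolding units.simps add_mult_distrib by linarith
    then show ?thesis using big_step.CondTrue[OF False 1(1)] 1(3-5) by blast
  next
    case True
    then obtain t m s' where 1: "big_step c2 s t m s'" "t \<le> units s0 c2 * (L + 1)\<^sup>2"
      "m \<le> 16 * B * (1 + 2 * L)" "small B L s'" "Q s'"
      using assms(2) s unfolding run_def by blast
    have "1 + acost e s + t \<le> units s0 (Cond e c1 c2) * (L + 1)\<^sup>2"
      using 1(2) cost one_le unfolding units.simps add_mult_distrib by linarith
    then show ?thesis using big_step.CondFalse[OF True 1(1)] 1(3-5) by blast
  qed
qed

text \<open>The invariant is indexed by the number of completed rounds. That number is fixed in
  advance by the nominal state, which ties the actual time to \<open>units\<close>.\<close>

lemma run_While:
  assumes step: "\<And>j s. \<lbrakk> j < m; small B L s; I j s \<rbrakk> \<Longrightarrow> aval e s \<noteq> 0 \<and> run c s (I (Suc j))"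
    and stop: "\<And>s. I m s \<Longrightarrow> aval e s = 0"
    and iter: "iterations s0 e = m" and init: "I 0 s"
  shows "run (While e c) s (I m)"
proof -
  let ?w = "1 + (expr_weight e)\<^sup>2"
  have "\<exists>t m' s'. big_step (While e c) s t m' s' \<and>
      t \<le> (?w + (m - j) * (?w + units s0 c)) * (L + 1)\<^sup>2 \<and> m' \<le> 16 * B * (1 + 2 * L) \<and>
      small B L s' \<and> I m s'" if "j \<le> m" "small B L s" "I j s" for j s
    using that
  proof (induction "m - j" arbitrary: j s)
    case 0
    then have j: "j = m" by simp
    have "1 + acost e s \<le> (?w + (m - j) * (?w + units s0 c)) * (L + 1)\<^sup>2"
      using acost_le[OF 0(3), of e] one_le unfolding add_mult_distrib by linarith
    then show ?case
      using big_step.WhileFalse[OF stop] 0(3,4) state_size_le[OF 0(3) B_le] unfolding j by blast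
  next
    case (Suc d)
    then have jm: "j < m" "d = m - Suc j" by auto
    have e: "aval e s \<noteq> 0" and r: "run c s (I (Suc j))" using step[OF jm(1) Suc.prems(2,3)] by auto
    obtain t1 m1 s1 where 1: "big_step c s t1 m1 s1" "t1 \<le> units s0 c * (L + 1)\<^sup>2"
      "m1 \<le> 16 * B * (1 + 2 * L)" "small B L s1" "I (Suc j) s1"
      using r Suc.prems(2) unfolding run_def by blast
    obtain t2 m2 s2 where 2: "big_step (While e c) s1 t2 m2 s2"
      "t2 \<le> (?w + (m - Suc j) * (?w + units s0 c)) * (L + 1)\<^sup>2"
      "m2 \<le> 16 * B * (1 + 2 * L)" "small B L s2" "I m s2"
      using Suc.hyps(1)[OF jm(2) _ 1(4,5)] jm by auto
    have "1 + acost e s + t1 + t2 \<le> (?w + units s0 c) * (L + 1)\<^sup>2 +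
        (?w + (m - Suc j) * (?w + units s0 c)) * (L + 1)\<^sup>2"
      using acost_le[OF Suc.prems(2), of e] 1(2) 2(2) one_le unfolding add_mult_distrib by linarith
    also have "\<dots> = (?w + Suc (m - Suc j) * (?w + units s0 c)) * (L + 1)\<^sup>2"
      by (simp add: algebra_simps)
    also have "Suc (m - Suc j) = m - j" using jm(1) by simp
    finally show ?case using big_step.WhileTrue[OF e 1(1) 2(1)] 1(3) 2(3-5) by (meson max.bounded_iff)
  qed
  from this[of 0 s] init show ?thesis unfolding run_def by (auto simp: iter)
qed

text \<open>The bound \<open>e\<close> is evaluated anew in each round, so every state satisfying
  the invariant must give it the nominal value; the body must hand back the counter
  unchanged.\<close>

lemma run_For:
  assumes x: "x < 16" and m: "m < 2 ^ L" and e0: "aval e s0 = m"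
    and init: "small B L s \<Longrightarrow> I 0 (s(x := (s x)(0 := 0)))"
    and bound: "\<And>j s. I j s \<Longrightarrow> aval e s = m"
    and body: "\<And>j s. \<lbrakk> j < m; small B L s; I j s; s x 0 = j \<rbrakk> \<Longrightarrow>
      run c s (\<lambda>s'. s' x 0 = j \<and> I (Suc j) (s'(x := (s' x)(0 := Suc j))))"
  shows "run (For x e c) s (I m)"
\<comment> \<open>From a state that is not small, \<open>run\<close> holds vacuously.\<close>
proof (cases "small B L s")
  case True
  let ?J = "\<lambda>j s. I j s \<and> s x 0 = j"
  have "run (While (Bop Less (Cell x (Const 0)) e)
       (Seq c (Store x (Const 0) (Bop Plus (Cell x (Const 0)) (Const 1)))))
     (s(x := (s x)(0 := 0))) (?J m)"
  proof (rule run_While)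
    fix j s assume j: "j < m" and s: "small B L s" and I: "?J j s"
    have "run (Seq c (Store x (Const 0) (Bop Plus (Cell x (Const 0)) (Const 1)))) s (?J (Suc j))"
    proof (rule run_Seq, rule run_mono)
      show "run c s (\<lambda>s'. s' x 0 = j \<and> I (Suc j) (s'(x := (s' x)(0 := Suc j))))"
        using body[OF j s] I by blast
      fix s' assume "s' x 0 = j \<and> I (Suc j) (s'(x := (s' x)(0 := Suc j)))"
      then show "run (Store x (Const 0) (Bop Plus (Cell x (Const 0)) (Const 1))) s' (?J (Suc j))"
        using x j m B_pos by (intro run_Store) auto
    qed
    then show "aval (Bop Less (Cell x (Const 0)) e) s \<noteq> 0 \<and>
        run (Seq c (Store x (Const 0) (Bop Plus (Cell x (Const 0)) (Const 1)))) s (?J (Suc j))"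
      using bound[of j s] I j by simp
  qed (use bound e0 init[OF True] in \<open>auto simp: fun_upd_def\<close>)
  then show ?thesis unfolding For_def
    using x B_pos by (intro run_Seq run_Store) (auto elim: run_mono)
qed (simp add: run_def)

end

section \<open>Vertex sets as bit masks\<close>

definition bits :: "nat \<Rightarrow> nat set" where
  "bits X = {i. bit X i}"

lemma bits_inject: "bits X = bits Y \<longleftrightarrow> X = Y"
  unfolding bits_def by (auto simp: set_eq_iff intro: bit_eqI)

lemma bits_0 [simp]: "bits 0 = {}"
  unfolding bits_def by simp

lemma bits_eq_empty_iff: "bits X = {} \<longleftrightarrow> X = 0"
  using bits_inject[of X 0] by simp

lemma less_power_iff_bits: "X < 2 ^ n \<longleftrightarrow> bits X \<subseteq> {..<n}" for X :: nat
proof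
  assume X: "X < 2 ^ n"
  have "i < n" if "bit X i" for i
  proof (rule ccontr)
    assume "\<not> i < n"
    then have "X < 2 ^ i" using X by (meson less_le_trans linorder_not_less one_le_numeral power_increasing)
    then show False using that by (simp add: bit_iff_odd)
  qed
  then show "bits X \<subseteq> {..<n}" unfolding bits_def by auto
next
  assume "bits X \<subseteq> {..<n}"
  then have "take_bit n X = X" unfolding bits_def by (intro bit_eqI) (auto simp: bit_take_bit_iff)
  then show "X < 2 ^ n" by (metis take_bit_nat_less_exp)
qed

lemma bits_power: "bits (2 ^ i) = {i}"
  unfolding bits_def by (auto simp: bit_exp_iff)

lemma bits_or: "bits (Bit_Operations.or X Y) = bits X \<union> bits Y"
  unfolding bits_def by (auto simp: bit_or_iff)

lemma bits_diff: "bits (Bit_Operations.xor X (Bit_Operations.and X Y)) = bits X - bits Y"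
  unfolding bits_def by (auto simp: bit_xor_iff bit_and_iff)

lemma bits_full: "bits (2 ^ n - 1) = {..<n}"
  unfolding bits_def mask_eq_exp_minus_1[symmetric] by (auto simp: bit_mask_iff)

text \<open>Subtracting a power whose bit is set clears that bit without a borrow. The strict
  decrease is what lets ascending masks find their predecessors already processed.\<close>

lemma bits_remove:
  assumes "i \<in> bits X"
  shows "bits (X - 2 ^ i) = bits X - {i}" "2 ^ i \<le> X" "X - 2 ^ i < X"
proof -
  have b: "bit X i" using assms unfolding bits_def by simp
  have "int (unset_bit i X) = int X - 2 ^ i"
    using b by (simp add: of_nat_unset_bit_eq unset_bit_eq bit_of_nat_iff)
  then have u: "X = unset_bit i X + 2 ^ i"
    by (metis (mono_tags) add_diff_cancel_right' diff_add_cancel of_nat_add of_nat_eq_iff of_nat_numeral of_nat_power)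
  then show le: "2 ^ i \<le> X" by (metis le_add2)
  then show "X - 2 ^ i < X" by (simp add: le_less_trans[OF _ less_le_trans[of 0 "2 ^ i" X]])
  have "X - 2 ^ i = unset_bit i X" using u by (metis add_diff_cancel_right')
  then show "bits (X - 2 ^ i) = bits X - {i}" unfolding bits_def by (auto simp: bit_unset_bit_iff)
qed


section \<open>Counting covers by zeta and Moebius transforms\<close>

text \<open>For \<open>i = 0\<close> this is equality, and once \<open>i\<close> exceeds all
  elements it is inclusion; the transforms move between these ends one element at a time.\<close>

definition agree_above :: "nat \<Rightarrow> nat set \<Rightarrow> nat set \<Rightarrow> bool" where
  "agree_above i A D \<longleftrightarrow> A \<subseteq> D \<and> A - {..<i} = D - {..<i}"

text \<open>The zeta transform of \<open>\<lambda>D. card {p \<in> P. u p = D}\<close> with respect to the elements below \<open>i\<close>.\<close>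

definition partial_zeta :: "('p \<Rightarrow> nat set) \<Rightarrow> 'p set \<Rightarrow> nat \<Rightarrow> nat \<Rightarrow> nat" where
  "partial_zeta u P i X = card {p \<in> P. agree_above i (u p) (bits X)}"

lemma partial_zeta_0: "partial_zeta u P 0 X = card {p \<in> P. u p = bits X}"
  unfolding partial_zeta_def agree_above_def by (rule arg_cong[of _ _ card]) auto

lemma partial_zeta_Suc:
  assumes "finite P"
  shows "partial_zeta u P (Suc i) X =
    partial_zeta u P i X + (if i \<in> bits X then partial_zeta u P i (X - 2 ^ i) else 0)"
proof (cases "i \<in> bits X")
  case True
  have split: "agree_above (Suc i) A D \<longleftrightarrow> agree_above i A D \<or> agree_above i A (D - {i})"
    and disj: "\<not> (agree_above i A D \<and> agree_above i A (D - {i}))" if "i \<in> D" for A D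
    using that unfolding agree_above_def lessThan_Suc by (auto simp: set_eq_iff)
  have "{p \<in> P. agree_above (Suc i) (u p) (bits X)} =
      {p \<in> P. agree_above i (u p) (bits X)} \<union> {p \<in> P. agree_above i (u p) (bits (X - 2 ^ i))}"
    using split[OF True] bits_remove(1)[OF True] by auto
  moreover have "{p \<in> P. agree_above i (u p) (bits X)} \<inter>
      {p \<in> P. agree_above i (u p) (bits (X - 2 ^ i))} = {}"
    using disj[OF True] bits_remove(1)[OF True] by auto
  ultimately show ?thesis using assms True unfolding partial_zeta_def by (simp add: card_Un_disjoint)
next
  case False
  have "agree_above (Suc i) A (bits X) \<longleftrightarrow> agree_above i A (bits X)" for A
    using False unfolding agree_above_def lessThan_Suc by (auto simp: set_eq_iff)
  then show ?thesis using False unfolding partial_zeta_def by simp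
qed

lemma partial_zeta_full:
  assumes "\<And>p. p \<in> P \<Longrightarrow> u p \<subseteq> {..<n}" "X < 2 ^ n"
  shows "partial_zeta u P n X = card {p \<in> P. u p \<subseteq> bits X}"
proof -
  have "agree_above n (u p) (bits X) \<longleftrightarrow> u p \<subseteq> bits X" if "p \<in> P" for p
    using assms(1)[OF that] assms(2) less_power_iff_bits[of X n] unfolding agree_above_def by auto
  then show ?thesis unfolding partial_zeta_def by (metis (mono_tags, lifting))
qed

lemma partial_zeta_le: "finite P \<Longrightarrow> partial_zeta u P i X \<le> card P"
  unfolding partial_zeta_def by (intro card_mono) auto

section \<open>Lists of cliques and the covers they form\<close>

locale tcl_instance =
  fixes n :: nat and E :: "nat set set"
  assumes graph: "simple_graph {..<n} E"
begin

abbreviation V :: "nat set" where "V \<equiv> {..<n}"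

definition cliques :: "nat set set" where
  "cliques = {K. clique V E K}"

definition clique_count :: "nat \<Rightarrow> nat" where
  "clique_count X = card {K \<in> cliques. K \<subseteq> bits X}"

definition clique_lists :: "nat \<Rightarrow> nat set list set" where
  "clique_lists k = {xs. set xs \<subseteq> cliques \<and> length xs = k}"

definition cover_count :: "nat \<Rightarrow> nat \<Rightarrow> nat \<Rightarrow> nat" where
  "cover_count k = partial_zeta (\<lambda>xs. \<Union>(set xs)) (clique_lists k)"

lemma cliques_subset: "cliques \<subseteq> Pow V"
  unfolding cliques_def clique_def by auto

lemma finite_cliques: "finite cliques"
  using cliques_subset finite_subset by blast

lemma card_cliques_le: "card cliques \<le> 2 ^ n"
  using card_mono[OF _ cliques_subset] by (simp add: card_Pow)

lemma finite_clique_lists: "finite (clique_lists k)"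
  unfolding clique_lists_def using finite_lists_length_eq[OF finite_cliques] by simp

lemma card_clique_lists: "card (clique_lists k) \<le> 2 ^ (n * k)"
proof -
  have "card (clique_lists k) = card cliques ^ k"
    unfolding clique_lists_def by (rule card_lists_length_eq[OF finite_cliques])
  also have "\<dots> \<le> (2 ^ n) ^ k" by (rule power_mono[OF card_cliques_le]) simp
  finally show ?thesis by (simp add: power_mult)
qed

lemma clique_count_le: "clique_count X \<le> 2 ^ n"
proof -
  have "clique_count X \<le> card cliques" unfolding clique_count_def
    by (intro card_mono finite_cliques) auto
  then show ?thesis using card_cliques_le by simp
qed

lemma clique_count_power_le: "clique_count X ^ k \<le> 2 ^ (n * k)"
  using power_mono[OF clique_count_le, of X k] by (simp add: power_mult)

lemma partial_zeta_cliques_0: "partial_zeta id cliques 0 X = of_bool (clique V E (bits X))"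
proof -
  have "{p \<in> cliques. id p = bits X} = (if clique V E (bits X) then {bits X} else {})"
    unfolding cliques_def by auto
  then show ?thesis by (simp add: partial_zeta_0)
qed

lemma partial_zeta_cliques_n:
  assumes "X < 2 ^ n"
  shows "partial_zeta id cliques n X = clique_count X"
  unfolding clique_count_def using partial_zeta_full[of cliques id n X] cliques_subset assms by auto

lemma cover_count_n:
  assumes "X < 2 ^ n"
  shows "cover_count k n X = clique_count X ^ k"
proof -
  have "\<Union>(set xs) \<subseteq> V" if "xs \<in> clique_lists k" for xs
    using that cliques_subset unfolding clique_lists_def by auto
  then have "cover_count k n X = card {xs \<in> clique_lists k. \<Union>(set xs) \<subseteq> bits X}"
    unfolding cover_count_def by (intro partial_zeta_full assms) auto
  also have "{xs \<in> clique_lists k. \<Union>(set xs) \<subseteq> bits X} =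
      {xs. set xs \<subseteq> {K \<in> cliques. K \<subseteq> bits X} \<and> length xs = k}"
    unfolding clique_lists_def by auto
  also have "card \<dots> = clique_count X ^ k"
    unfolding clique_count_def using finite_cliques by (intro card_lists_length_eq) auto
  finally show ?thesis .
qed

lemma cover_count_Suc:
  "cover_count k (Suc i) X =
    cover_count k i X + (if i \<in> bits X then cover_count k i (X - 2 ^ i) else 0)"
  unfolding cover_count_def by (rule partial_zeta_Suc[OF finite_clique_lists])

lemma cover_count_le: "cover_count k i X \<le> 2 ^ (n * k)"
  unfolding cover_count_def
  using partial_zeta_le[OF finite_clique_lists] card_clique_lists order_trans by blast

lemma cover_count_0_pos_iff: "0 < cover_count k 0 X \<longleftrightarrow> clique_coverable V E k (bits X)"
proof -
  have "0 < cover_count k 0 X \<longleftrightarrow> (\<exists>xs\<in>clique_lists k. \<Union>(set xs) = bits X)"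
    unfolding cover_count_def partial_zeta_0 using finite_clique_lists[of k] by (auto simp: card_gt_0_iff)
  also have "\<dots> \<longleftrightarrow> clique_coverable V E k (bits X)"
  proof
    assume "\<exists>xs\<in>clique_lists k. \<Union>(set xs) = bits X"
    then show "clique_coverable V E k (bits X)"
      unfolding clique_coverable_def clique_lists_def cliques_def using card_length by blast
  next
    assume "clique_coverable V E k (bits X)"
    then obtain C where C: "finite C" "card C \<le> k" "\<forall>K\<in>C. clique V E K" "\<Union>C = bits X"
      unfolding clique_coverable_def by blast
    obtain xs where xs: "set xs = C" "distinct xs" using finite_distinct_list[OF C(1)] by blast
    have len: "length xs \<le> k" using xs C(2) distinct_card by fastforce
    have "clique V E {}" unfolding clique_def by simp
    then have "xs @ replicate (k - length xs) {} \<in> clique_lists k"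
      using C(3) xs(1) len unfolding clique_lists_def cliques_def by auto
    moreover have "\<Union>(set (xs @ replicate (k - length xs) {})) = bits X" using C(4) xs(1) by auto
    ultimately show "\<exists>xs\<in>clique_lists k. \<Union>(set xs) = bits X" by blast
  qed
  finally show ?thesis .
qed

text \<open>Masks turn the recursion over sets into one over numbers: \<open>S - 2 ^ v\<close> is
  smaller than \<open>S\<close>, so ascending order evaluates it.\<close>

lemma eliminable_bits_iff:
  assumes "S < 2 ^ n"
  shows "eliminable V E k (bits S) \<longleftrightarrow> S = 0 \<or> (\<exists>v\<in>bits S. eliminable V E k (bits (S - 2 ^ v)) \<and>
    clique_coverable V E k (elim_bag E (bits S) v))"
proof
  assume "eliminable V E k (bits S)"
  then show "S = 0 \<or> (\<exists>v\<in>bits S. eliminable V E k (bits (S - 2 ^ v)) \<and>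
    clique_coverable V E k (elim_bag E (bits S) v))"
    by (cases rule: eliminable.cases) (auto simp: bits_eq_empty_iff bits_remove(1))
next
  assume "S = 0 \<or> (\<exists>v\<in>bits S. eliminable V E k (bits (S - 2 ^ v)) \<and>
    clique_coverable V E k (elim_bag E (bits S) v))"
  then show "eliminable V E k (bits S)"
    using assms less_power_iff_bits[of S n]
    by (auto simp: bits_remove(1) intro: eliminable.empty eliminable.step)
qed

text \<open>The failing \<open>k\<close> form an initial segment as long as the width. Counting them
  replaces a search with early exit by a plain loop.\<close>

lemma card_not_eliminable: "card {k. k < n \<and> \<not> eliminable V E k V} = tcl V E"
proof -
  have le: "tcl V E \<le> n" using eliminable_card[OF graph] tcl_le_iff[OF graph] by simp
  have "{k. k < n \<and> \<not> eliminable V E k V} = {..<tcl V E}"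
    using le by (auto simp: tcl_le_iff[OF graph, symmetric])
  then show ?thesis by simp
qed

end


section \<open>The program\<close>

abbreviation "scalar x \<equiv> Cell x (Const 0)"

abbreviation "vertex_count \<equiv> scalar 0"

abbreviation "power_of_two e \<equiv> Cell 3 e"

abbreviation "mask_count \<equiv> power_of_two vertex_count"

abbreviation "bit_test i X \<equiv> Bop Mod (Bop Div X (power_of_two i)) (Const 2)"

abbreviation "pair_count \<equiv> Bop Times vertex_count vertex_count"

abbreviation "pair_fst \<equiv> Bop Div (scalar 10) vertex_count"

abbreviation "pair_snd \<equiv> Bop Mod (scalar 10) vertex_count"

text \<open>
  Arrays 0 to 2 are the input. Array 3 holds powers of two, array 4 the clique indicator and
  then its zeta transform, array 5 the powers of the latter, array 6 the numbers of covers, and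
  array 7 the indicator of eliminable sets. Arrays 8 to 14 are scalars: a vertex, a bit mask, an
  index into the adjacency matrix, a round number, \<open>k\<close>, the set of reached vertices,
  and the number of all \<open>k\<close> so far for which the vertex set is not eliminable.
\<close>

definition powers_prog :: com where
  "powers_prog = Seq (Store 3 (Const 0) (Const 1))
     (For 8 vertex_count (Store 3 (Bop Plus (scalar 8) (Const 1))
       (Bop Times (Const 2) (power_of_two (scalar 8)))))"

definition cliques_prog :: com where
  "cliques_prog = For 9 mask_count
     (Seq (Store 4 (scalar 9) (Const 1))
     (Seq (Store 5 (scalar 9) (Const 1))
       (For 10 pair_count
         (Cond (Bop Times (Bop Times (bit_test pair_fst (scalar 9)) (bit_test pair_snd (scalar 9)))
             (Bop Times (Bop Equal (Bop Equal pair_fst pair_snd) (Const 0))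
               (Bop Equal (Cell 1 (scalar 10)) (Const 0))))
           (Store 4 (scalar 9) (Const 0)) Skip))))"

definition zeta_prog :: com where
  "zeta_prog = For 8 vertex_count (For 9 mask_count
     (Cond (bit_test (scalar 8) (scalar 9))
       (Store 4 (scalar 9) (Bop Plus (Cell 4 (scalar 9))
         (Cell 4 (Bop Minus (scalar 9) (power_of_two (scalar 8)))))) Skip))"

text \<open>The inversion overwrites array 6, so the current power is kept in array 5 and extended
  by one factor per round.\<close>

definition next_power_prog :: com where
  "next_power_prog = For 9 mask_count
     (Seq (Store 6 (scalar 9) (Cell 5 (scalar 9)))
       (Store 5 (scalar 9) (Bop Times (Cell 5 (scalar 9)) (Cell 4 (scalar 9)))))"

text \<open>The zeta transform goes through the vertices upwards. Inverting downwards makes each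
  intermediate array a \<open>partial_zeta\<close> again.\<close>

abbreviation "reverse_index \<equiv> Bop Minus (Bop Minus vertex_count (Const 1)) (scalar 8)"

definition moebius_prog :: com where
  "moebius_prog = For 8 vertex_count (For 9 mask_count
     (Cond (bit_test reverse_index (scalar 9))
       (Store 6 (scalar 9) (Bop Minus (Cell 6 (scalar 9))
         (Cell 6 (Bop Minus (scalar 9) (power_of_two reverse_index))))) Skip))"

text \<open>Each pass tries every ordered pair as an edge leaving a marked member of the current
  set. \<open>pair_count\<close> passes suffice since the relation has at most that many
  pairs.\<close>

definition reach_prog :: com where
  "reach_prog = Seq (Store 13 (Const 0) (power_of_two (scalar 8)))
     (For 11 pair_count (For 10 pair_count
       (Cond (Bop Times (Cell 1 (scalar 10))
           (Bop Times (bit_test pair_fst (scalar 13)) (bit_test pair_fst (scalar 9))))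
         (Store 13 (Const 0) (Bop BitOr (scalar 13) (power_of_two pair_snd))) Skip)))"

abbreviation "rest_mask \<equiv> Bop Minus (scalar 9) (power_of_two (scalar 8))"

text \<open>The combination of \<open>BitXor\<close> and \<open>BitAnd\<close> is set difference: it
  removes the previously eliminated vertices from the reached ones and leaves the bag.\<close>

definition try_vertex_prog :: com where
  "try_vertex_prog = Cond (bit_test (scalar 8) (scalar 9))
     (Cond (Cell 7 rest_mask)
       (Seq reach_prog
         (Cond (Cell 6 (Bop BitXor (scalar 13) (Bop BitAnd (scalar 13) rest_mask)))
           (Store 7 (scalar 9) (Const 1)) Skip)) Skip) Skip"

definition eliminable_prog :: com where
  "eliminable_prog = For 9 mask_count
     (Seq (Store 7 (scalar 9) (Bop Equal (scalar 9) (Const 0)))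
       (For 8 vertex_count try_vertex_prog))"

definition round_prog :: com where
  "round_prog = Seq next_power_prog (Seq moebius_prog (Seq eliminable_prog
     (Store 14 (Const 0) (Bop Plus (scalar 14)
       (Bop Equal (Cell 7 (Bop Minus mask_count (Const 1))) (Const 0))))))"

definition tcl_prog :: com where
  "tcl_prog = Seq powers_prog (Seq cliques_prog (Seq zeta_prog
     (Seq (For 12 vertex_count round_prog) (Store 0 (Const 0) (scalar 14)))))"

text \<open>The factor \<open>n\<close> makes room for \<open>2 ^ n\<close> characteristic vectors
  of length \<open>n\<close> in the input. The summand 2 accommodates masks and scalars, even for
  \<open>n = 0\<close>.\<close>

definition index_bound :: "nat \<Rightarrow> nat" where
  "index_bound n = (n + 2) * 2 ^ n"

text \<open>Powers of clique counts reach \<open>2 ^ (n * n)\<close>, and the index bound is at most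
  \<open>2 ^ (2 * n + 1)\<close>; the sum of both exponents covers either.\<close>

definition word_length :: "nat \<Rightarrow> nat" where
  "word_length n = n * n + 2 * n + 2"

text \<open>It only has to give the loop bounds their values. Array 3 is read there at index
  \<open>n\<close> alone, so it may be constant.\<close>

definition nominal_state :: "nat \<Rightarrow> state" where
  "nominal_state n x i = (if x = 0 then n else if x = 3 then 2 ^ n else 0)"

lemma add_two_le_power: "n + 2 \<le> 2 ^ (n + 1)"
  by (induction n) auto

lemma index_bound_le: "index_bound n \<le> 2 ^ word_length n"
proof -
  have "index_bound n \<le> 2 ^ (n + 1) * 2 ^ n"
    unfolding index_bound_def by (rule mult_right_mono[OF add_two_le_power]) simp
  also have "\<dots> = 2 ^ (n + 1 + n)" by (rule power_add[symmetric])
  also have "\<dots> \<le> 2 ^ word_length n" unfolding word_length_def by (rule power_increasing) auto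
  finally show ?thesis .
qed

sublocale tcl_instance \<subseteq> bounded_ram "index_bound n" "word_length n" "nominal_state n"
  by unfold_locales (rule index_bound_le, simp add: index_bound_def)

text \<open>A frame condition: \<open>F\<close> stands for whatever the caller knows that survives
  arbitrary changes to the arrays in \<open>A\<close>. Each program part can thus be verified once
  and used in any context.\<close>

definition frame :: "nat set \<Rightarrow> (state \<Rightarrow> bool) \<Rightarrow> bool" where
  "frame A F \<longleftrightarrow> (\<forall>x\<in>A. \<forall>s f. F s \<longrightarrow> F (s(x := f)))"

context tcl_instance
begin

lemma index_lt: "i \<le> n \<Longrightarrow> i < index_bound n" "X < 2 ^ n \<Longrightarrow> X < index_bound n"
  "0 < index_bound n"
proof -
  have "n < 2 ^ n" by (rule less_exp)
  moreover have "2 ^ n \<le> index_bound n" unfolding index_bound_def by simp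
  ultimately show "i \<le> n \<Longrightarrow> i < index_bound n" "X < 2 ^ n \<Longrightarrow> X < index_bound n" "0 < index_bound n"
    by linarith+
qed

lemma value_lt: "v \<le> 2 ^ (n * n) \<Longrightarrow> v < 2 ^ word_length n"
  "v \<le> 2 ^ n \<Longrightarrow> v < 2 ^ word_length n" "v \<le> n * n \<Longrightarrow> v < 2 ^ word_length n"
  "v \<le> n \<Longrightarrow> v < 2 ^ word_length n"
proof -
  have 1: "2 ^ (n * n) < (2 ^ word_length n :: nat)" "2 ^ n < (2 ^ word_length n :: nat)"
    by (rule power_strict_increasing; simp add: word_length_def)+
  have 2: "n * n < 2 ^ (n * n)" "n < 2 ^ n" by (rule less_exp)+
  show "v \<le> 2 ^ (n * n) \<Longrightarrow> v < 2 ^ word_length n"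
  "v \<le> 2 ^ n \<Longrightarrow> v < 2 ^ word_length n" "v \<le> n * n \<Longrightarrow> v < 2 ^ word_length n"
  "v \<le> n \<Longrightarrow> v < 2 ^ word_length n"
    using 1 2 by linarith+
qed

section \<open>Correctness of the program parts\<close>

definition input_ok :: "state \<Rightarrow> bool" where
  "input_ok s \<longleftrightarrow> s 0 0 = n \<and> (\<forall>p<n * n. s 1 p = of_bool ({p div n, p mod n} \<in> E))"

definition base :: "state \<Rightarrow> bool" where
  "base s \<longleftrightarrow> input_ok s \<and> (\<forall>i\<le>n. s 3 i = 2 ^ i)"

lemma input_ok_upd [simp]: "x \<noteq> 0 \<Longrightarrow> x \<noteq> 1 \<Longrightarrow> input_ok (s(x := f)) = input_ok s"
  unfolding input_ok_def by simp

lemma base_upd [simp]: "x \<noteq> 0 \<Longrightarrow> x \<noteq> 1 \<Longrightarrow> x \<noteq> 3 \<Longrightarrow> base (s(x := f)) = base s"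
  unfolding base_def by simp

lemma base_power: "base s \<Longrightarrow> i \<le> n \<Longrightarrow> s 3 i = 2 ^ i"
  unfolding base_def by simp

lemma base_n: "base s \<Longrightarrow> s 0 0 = n"
  unfolding base_def input_ok_def by simp

lemma base_adj: "base s \<Longrightarrow> p < n * n \<Longrightarrow> s (Suc 0) p = of_bool ({p div n, p mod n} \<in> E)"
  unfolding base_def input_ok_def by simp

lemma bit_value: "X div 2 ^ i mod 2 = (of_bool (i \<in> bits X) :: nat)"
  unfolding bits_def by (simp add: bit_iff_odd mod_2_eq_odd)

lemma pair_lt: "p < n * n \<Longrightarrow> p div n < n" "p < n * n \<Longrightarrow> p mod n < n"
  by (cases "n = 0"; simp add: less_mult_imp_div_less)+

lemma pair_encode:
  assumes "x < n" "y < n"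
  shows "x * n + y < n * n" "(x * n + y) div n = x" "(x * n + y) mod n = y"
proof -
  have "x * n + y < (x + 1) * n" using assms(2) by simp
  also have "\<dots> \<le> n * n" using assms(1) by (intro mult_right_mono) auto
  finally show "x * n + y < n * n" .
qed (use assms in auto)

lemma run_For_mono:
  assumes "x < 16" "m < 2 ^ word_length n" "aval e (nominal_state n) = m"
    and "small (index_bound n) (word_length n) s \<Longrightarrow> I 0 (s(x := (s x)(0 := 0)))"
    and "\<And>j s. I j s \<Longrightarrow> aval e s = m"
    and "\<And>j s. \<lbrakk> j < m; I j s; s x 0 = j \<rbrakk> \<Longrightarrow>
      run c s (\<lambda>s'. s' x 0 = j \<and> I (Suc j) (s'(x := (s' x)(0 := Suc j))))"
    and "\<And>s'. I m s' \<Longrightarrow> Q s'"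
  shows "run (For x e c) s Q"
  by (rule run_mono[OF run_For[where I = I, OF assms(1-5)]]) (use assms(6,7) in auto)

lemma run_powers:
  assumes "input_ok s" "frame {3, 8} F" "F s"
  shows "run powers_prog s (\<lambda>s'. F s' \<and> base s')"
proof -
  let ?I = "\<lambda>j s. F s \<and> input_ok s \<and> (\<forall>i\<le>j. s 3 i = 2 ^ i)"
  have F: "\<And>s f. F s \<Longrightarrow> F (s(3 := f))" "\<And>s f. F s \<Longrightarrow> F (s(8 := f))"
    using assms(2) unfolding frame_def by auto
  show ?thesis
    unfolding powers_prog_def
  proof (rule run_Seq, rule run_Store)
    show "run (For 8 vertex_count (Store 3 (Bop Plus (scalar 8) (Const 1))
       (Bop Times (Const 2) (power_of_two (scalar 8)))))
      (s(3 := (s 3)(aval (Const 0) s := aval (Const 1) s))) (\<lambda>s'. F s' \<and> base s')"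
    proof (rule run_For_mono[where m = n and I = ?I])
      fix j s assume j: "j < n" "?I j s" "s 8 0 = j"
      have "2 * 2 ^ j \<le> (2 ^ n :: nat)" using j(1) power_increasing[of "Suc j" n "2::nat"] by simp
      then show "run (Store 3 (Bop Plus (scalar 8) (Const 1)) (Bop Times (Const 2) (power_of_two (scalar 8)))) s
          (\<lambda>s'. s' 8 0 = j \<and> ?I (Suc j) (s'(8 := (s' 8)(0 := Suc j))))"
        using j by (intro run_Store) (auto simp: F index_lt le_Suc_eq intro!: value_lt(2))
    qed (use assms F in \<open>auto simp: nominal_state_def value_lt input_ok_def base_def\<close>)
  qed (auto simp: index_lt value_lt)
qed

definition non_edge :: "nat \<Rightarrow> nat \<Rightarrow> bool" where
  "non_edge X q \<longleftrightarrow> q div n \<in> bits X \<and> q mod n \<in> bits X \<and> q div n \<noteq> q mod n \<and> {q div n, q mod n} \<notin> E"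

lemma clique_iff_non_edge:
  assumes "X < 2 ^ n"
  shows "clique V E (bits X) \<longleftrightarrow> (\<forall>q<n * n. \<not> non_edge X q)"
proof
  assume "clique V E (bits X)"
  then show "\<forall>q<n * n. \<not> non_edge X q" unfolding clique_def non_edge_def by blast
next
  assume no: "\<forall>q<n * n. \<not> non_edge X q"
  show "clique V E (bits X)"
    unfolding clique_def
  proof (intro conjI ballI impI)
    show sub: "bits X \<subseteq> V" using assms less_power_iff_bits by blast
    fix u v assume uv: "u \<in> bits X" "v \<in> bits X" "u \<noteq> v"
    then have "u < n" "v < n" using sub by auto
    from no[rule_format, OF pair_encode(1)[OF this]] pair_encode(2,3)[OF this] uv
    show "{u, v} \<in> E" unfolding non_edge_def by auto
  qed
qed

text \<open>Each mask counts as a clique until a missing edge is found. The ones left in array 5 are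
  the zeroth powers for the first round.\<close>

lemma run_cliques:
  assumes "base s" "frame {4, 5, 9, 10} F" "F s"
  shows "run cliques_prog s (\<lambda>s'. F s' \<and> base s' \<and>
    (\<forall>X<2 ^ n. s' 4 X = of_bool (clique V E (bits X)) \<and> s' 5 X = 1))"
proof -
  let ?done = "\<lambda>j s. \<forall>X<j. s 4 X = of_bool (clique V E (bits X)) \<and> s 5 X = 1"
  let ?I = "\<lambda>j s. F s \<and> base s \<and> ?done j s"
  have F: "\<And>s f. F s \<Longrightarrow> F (s(4 := f))" "\<And>s f. F s \<Longrightarrow> F (s(5 := f))"
    "\<And>s f. F s \<Longrightarrow> F (s(9 := f))" "\<And>s f. F s \<Longrightarrow> F (s(10 := f))"
    using assms(2) unfolding frame_def by auto
  show ?thesis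
    unfolding cliques_prog_def
  proof (rule run_For_mono[where m = "2 ^ n" and I = ?I])
    fix X s assume X: "X < 2 ^ n" "?I X s" "s 9 0 = X"
    let ?J = "\<lambda>p s. ?I X s \<and> s 9 0 = X \<and> s 5 X = 1 \<and> s 4 X = of_bool (\<forall>q<p. \<not> non_edge X q)"
    show "run (Seq (Store 4 (scalar 9) (Const 1)) (Seq (Store 5 (scalar 9) (Const 1))
       (For 10 pair_count
         (Cond (Bop Times (Bop Times (bit_test pair_fst (scalar 9)) (bit_test pair_snd (scalar 9)))
             (Bop Times (Bop Equal (Bop Equal pair_fst pair_snd) (Const 0))
               (Bop Equal (Cell 1 (scalar 10)) (Const 0))))
           (Store 4 (scalar 9) (Const 0)) Skip)))) s
      (\<lambda>s'. s' 9 0 = X \<and> ?I (Suc X) (s'(9 := (s' 9)(0 := Suc X))))"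
    proof (rule run_Seq, rule run_Store, goal_cases)
      case 4
      show ?case
      proof (rule run_Seq, rule run_Store, goal_cases)
        case 4
        show ?case
        proof (rule run_For_mono[where m = "n * n" and I = ?J])
          fix p s assume p: "p < n * n" "?J p s" "s 10 0 = p"
          let ?t = "Bop Times (Bop Times (bit_test pair_fst (scalar 9)) (bit_test pair_snd (scalar 9)))
             (Bop Times (Bop Equal (Bop Equal pair_fst pair_snd) (Const 0))
               (Bop Equal (Cell 1 (scalar 10)) (Const 0)))"
          have t: "aval ?t s \<noteq> 0 \<longleftrightarrow> non_edge X p"
            using p pair_lt[OF p(1)] by (simp add: base_n base_power base_adj bit_value non_edge_def)
          show "run (Cond ?t (Store 4 (scalar 9) (Const 0)) Skip) s
            (\<lambda>s'. s' 10 0 = p \<and> ?J (Suc p) (s'(10 := (s' 10)(0 := Suc p))))"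
          proof (rule run_Cond, unfold t, goal_cases)
            case 1
            then show ?case using p X by (intro run_Store) (auto simp: F index_lt less_Suc_eq)
          next
            case 2
            then show ?case using p t by (intro run_Skip) (auto simp: F less_Suc_eq)
          qed
        qed (use X F in \<open>auto simp: nominal_state_def value_lt base_n clique_iff_non_edge less_Suc_eq\<close>)
      qed (use X in \<open>auto simp: index_lt value_lt\<close>)
    qed (use X in \<open>auto simp: index_lt value_lt\<close>)
  qed (use assms F in \<open>auto simp: nominal_state_def value_lt base_n base_power\<close>)
qed


lemma run_zeta:
  assumes "F s" "frame {4, 8, 9} F" and base: "\<And>s. F s \<Longrightarrow> base s"
    and init: "\<forall>X<2 ^ n. s 4 X = of_bool (clique V E (bits X))"
  shows "run zeta_prog s (\<lambda>s'. F s' \<and> (\<forall>X<2 ^ n. s' 4 X = clique_count X))"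
proof -
  let ?z = "partial_zeta id cliques"
  let ?I = "\<lambda>i s. F s \<and> (\<forall>X<2 ^ n. s 4 X = ?z i X)"
  have F: "\<And>s f. F s \<Longrightarrow> F (s(4 := f))" "\<And>s f. F s \<Longrightarrow> F (s(8 := f))"
    "\<And>s f. F s \<Longrightarrow> F (s(9 := f))"
    using assms(2) unfolding frame_def by auto
  note base_simps = base_n[OF base] base_power[OF base]
  show ?thesis
    unfolding zeta_prog_def
  proof (rule run_For_mono[where m = n and I = ?I])
    fix i s assume i: "i < n" "?I i s" "s 8 0 = i"
    let ?J = "\<lambda>X s. F s \<and> s 8 0 = i \<and> (\<forall>Y<2 ^ n. s 4 Y = ?z (if Y < X then Suc i else i) Y)"
    show "run (For 9 mask_count
       (Cond (bit_test (scalar 8) (scalar 9))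
         (Store 4 (scalar 9) (Bop Plus (Cell 4 (scalar 9))
           (Cell 4 (Bop Minus (scalar 9) (power_of_two (scalar 8)))))) Skip)) s
      (\<lambda>s'. s' 8 0 = i \<and> ?I (Suc i) (s'(8 := (s' 8)(0 := Suc i))))"
    proof (rule run_For_mono[where m = "2 ^ n" and I = ?J])
      fix X s assume X: "X < 2 ^ n" "?J X s" "s 9 0 = X"
      have t: "aval (bit_test (scalar 8) (scalar 9)) s \<noteq> 0 \<longleftrightarrow> i \<in> bits X"
        using X i(1) by (simp add: base_simps bit_value)
      show "run (Cond (bit_test (scalar 8) (scalar 9))
         (Store 4 (scalar 9) (Bop Plus (Cell 4 (scalar 9))
           (Cell 4 (Bop Minus (scalar 9) (power_of_two (scalar 8)))))) Skip) s
        (\<lambda>s'. s' 9 0 = X \<and> ?J (Suc X) (s'(9 := (s' 9)(0 := Suc X))))"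
      proof (rule run_Cond, unfold t)
        assume iX: "i \<in> bits X"
        note rem = bits_remove[OF iX]
        \<comment> \<open>The smaller mask has already been updated in place; as it lacks
          \<open>i\<close>, both stages agree on it and the old value is still there.\<close>
        have "?z (Suc i) (X - 2 ^ i) = ?z i (X - 2 ^ i)"
          using partial_zeta_Suc[OF finite_cliques, of id i "X - 2 ^ i"] rem(1) by simp
        then have v: "s 4 X + s 4 (X - 2 ^ i) = ?z (Suc i) X"
          using X rem(3) iX partial_zeta_Suc[OF finite_cliques, of id i X] by simp
        moreover have "?z (Suc i) X \<le> 2 ^ n"
          using partial_zeta_le[OF finite_cliques] card_cliques_le order_trans by blast
        ultimately show "run (Store 4 (scalar 9) (Bop Plus (Cell 4 (scalar 9))
           (Cell 4 (Bop Minus (scalar 9) (power_of_two (scalar 8)))))) s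
          (\<lambda>s'. s' 9 0 = X \<and> ?J (Suc X) (s'(9 := (s' 9)(0 := Suc X))))"
          using X i(1) by (intro run_Store) (auto simp: F base_simps index_lt value_lt less_Suc_eq)
      next
        assume "aval (bit_test (scalar 8) (scalar 9)) s = 0"
        then have "i \<notin> bits X" using t by blast
        then show "run Skip s (\<lambda>s'. s' 9 0 = X \<and> ?J (Suc X) (s'(9 := (s' 9)(0 := Suc X))))"
          using X partial_zeta_Suc[OF finite_cliques, of id i X]
          by (intro run_Skip) (auto simp: F less_Suc_eq)
      qed
    qed (use i F in \<open>auto simp: nominal_state_def value_lt base_simps\<close>)
  qed (use assms F in \<open>auto simp: nominal_state_def value_lt base_simps partial_zeta_cliques_0 partial_zeta_cliques_n\<close>)
qed

lemma run_next_power: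
  assumes "F s" "frame {5, 6, 9} F" and base: "\<And>s. F s \<Longrightarrow> base s"
    and zeta: "\<And>s X. F s \<Longrightarrow> X < 2 ^ n \<Longrightarrow> s 4 X = clique_count X"
    and k: "k < n" and init: "\<forall>X<2 ^ n. s 5 X = clique_count X ^ k"
  shows "run next_power_prog s (\<lambda>s'. F s' \<and>
    (\<forall>X<2 ^ n. s' 5 X = clique_count X ^ Suc k \<and> s' 6 X = clique_count X ^ k))"
proof -
  let ?I = "\<lambda>X s. F s \<and> (\<forall>Y<2 ^ n. s 5 Y = clique_count Y ^ (if Y < X then Suc k else k)) \<and>
    (\<forall>Y<X. s 6 Y = clique_count Y ^ k)"
  have F: "\<And>s f. F s \<Longrightarrow> F (s(5 := f))" "\<And>s f. F s \<Longrightarrow> F (s(6 := f))"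
    "\<And>s f. F s \<Longrightarrow> F (s(9 := f))"
    using assms(2) unfolding frame_def by auto
  note base_simps = base_n[OF base] base_power[OF base]
  \<comment> \<open>The power prepared for the next round has exponent \<open>Suc k\<close>, which
    is at most \<open>n\<close>.\<close>
  have bound: "clique_count X ^ j < 2 ^ word_length n" if "j \<le> n" for X j
  proof (rule value_lt(1))
    have "clique_count X ^ j \<le> 2 ^ (n * j)" by (rule clique_count_power_le)
    also have "\<dots> \<le> 2 ^ (n * n)" using that by (intro power_increasing mult_left_mono) auto
    finally show "clique_count X ^ j \<le> 2 ^ (n * n)" .
  qed
  show ?thesis
    unfolding next_power_prog_def
  proof (rule run_For_mono[where m = "2 ^ n" and I = ?I])
    fix X s assume X: "X < 2 ^ n" "?I X s" "s 9 0 = X"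
    show "run (Seq (Store 6 (scalar 9) (Cell 5 (scalar 9)))
       (Store 5 (scalar 9) (Bop Times (Cell 5 (scalar 9)) (Cell 4 (scalar 9))))) s
      (\<lambda>s'. s' 9 0 = X \<and> ?I (Suc X) (s'(9 := (s' 9)(0 := Suc X))))"
      using X k bound[of k X] bound[of "Suc k" X]
      by (intro run_Seq run_Store) (auto simp: F zeta index_lt less_Suc_eq mult.commute)
  qed (use assms F in \<open>auto simp: nominal_state_def value_lt base_simps\<close>)
qed

lemma run_moebius:
  assumes "F s" "frame {6, 8, 9} F" and base: "\<And>s. F s \<Longrightarrow> base s"
    and k: "k < n" and init: "\<forall>X<2 ^ n. s 6 X = clique_count X ^ k"
  shows "run moebius_prog s (\<lambda>s'. F s' \<and> (\<forall>X<2 ^ n. s' 6 X = cover_count k 0 X))"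
proof -
  let ?I = "\<lambda>j s. F s \<and> (\<forall>X<2 ^ n. s 6 X = cover_count k (n - j) X)"
  have F: "\<And>s f. F s \<Longrightarrow> F (s(6 := f))" "\<And>s f. F s \<Longrightarrow> F (s(8 := f))"
    "\<And>s f. F s \<Longrightarrow> F (s(9 := f))"
    using assms(2) unfolding frame_def by auto
  note base_simps = base_n[OF base] base_power[OF base]
  show ?thesis
    unfolding moebius_prog_def
  proof (rule run_For_mono[where m = n and I = ?I])
    fix j s assume j: "j < n" "?I j s" "s 8 0 = j"
    define i where "i = n - 1 - j"
    have i: "i < n" "n - j = Suc i" "n - Suc j = i" "n - Suc 0 - j = i" using j(1) unfolding i_def by auto
    let ?J = "\<lambda>X s. F s \<and> s 8 0 = j \<and> (\<forall>Y<2 ^ n. s 6 Y = cover_count k (if Y < X then i else Suc i) Y)"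
    show "run (For 9 mask_count
       (Cond (bit_test reverse_index (scalar 9))
         (Store 6 (scalar 9) (Bop Minus (Cell 6 (scalar 9))
           (Cell 6 (Bop Minus (scalar 9) (power_of_two reverse_index))))) Skip)) s
      (\<lambda>s'. s' 8 0 = j \<and> ?I (Suc j) (s'(8 := (s' 8)(0 := Suc j))))"
    proof (rule run_For_mono[where m = "2 ^ n" and I = ?J])
      fix X s assume X: "X < 2 ^ n" "?J X s" "s 9 0 = X"
      have t: "aval (bit_test reverse_index (scalar 9)) s \<noteq> 0 \<longleftrightarrow> i \<in> bits X"
        using X i by (simp add: base_simps bit_value)
      show "run (Cond (bit_test reverse_index (scalar 9))
         (Store 6 (scalar 9) (Bop Minus (Cell 6 (scalar 9))
           (Cell 6 (Bop Minus (scalar 9) (power_of_two reverse_index))))) Skip) s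
        (\<lambda>s'. s' 9 0 = X \<and> ?J (Suc X) (s'(9 := (s' 9)(0 := Suc X))))"
      proof (rule run_Cond, unfold t)
        assume iX: "i \<in> bits X"
        note rem = bits_remove[OF iX]
        \<comment> \<open>The mask \<open>X\<close> is still at stage \<open>Suc i\<close> while the
          smaller one is at stage \<open>i\<close>, exactly the two values that
          \<open>cover_count_Suc\<close> relates.\<close>
        have v: "s 6 X - s 6 (X - 2 ^ i) = cover_count k i X"
          using X rem(3) iX cover_count_Suc[of k i X] by simp
        have "cover_count k i X \<le> 2 ^ (n * k)" by (rule cover_count_le)
        also have "\<dots> \<le> 2 ^ (n * n)" using k by (intro power_increasing mult_left_mono) auto
        finally show "run (Store 6 (scalar 9) (Bop Minus (Cell 6 (scalar 9))
           (Cell 6 (Bop Minus (scalar 9) (power_of_two reverse_index))))) s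
          (\<lambda>s'. s' 9 0 = X \<and> ?J (Suc X) (s'(9 := (s' 9)(0 := Suc X))))"
          using X i v by (intro run_Store) (auto simp: F base_simps index_lt value_lt less_Suc_eq)
      next
        assume "aval (bit_test reverse_index (scalar 9)) s = 0"
        then have "i \<notin> bits X" using t by blast
        then show "run Skip s (\<lambda>s'. s' 9 0 = X \<and> ?J (Suc X) (s'(9 := (s' 9)(0 := Suc X))))"
          using X cover_count_Suc[of k i X] by (intro run_Skip) (auto simp: F less_Suc_eq)
      qed
    qed (use i j F in \<open>auto simp: nominal_state_def value_lt base_simps\<close>)
  qed (use assms F in \<open>auto simp: nominal_state_def value_lt base_simps cover_count_n\<close>)
qed

lemma out_edges_bits_rtrancl:
  assumes "S < 2 ^ n" "(v, w) \<in> (out_edges E (bits S))\<^sup>*"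
  shows "\<exists>j\<le>n * n. (v, w) \<in> out_edges E (bits S) ^^ j"
proof -
  let ?R = "out_edges E (bits S)"
  have sub: "?R \<subseteq> V \<times> V" using graph unfolding out_edges_def simple_graph_def by auto
  then have "card ?R \<le> card (V \<times> V)" by (intro card_mono) auto
  then have c: "card ?R \<le> n * n" by (simp add: card_cartesian_product)
  have "finite ?R" using sub finite_subset by blast
  from rtrancl_finite_eq_relpow[OF this] assms(2) obtain j where "j \<le> card ?R" "(v, w) \<in> ?R ^^ j" by auto
  then show ?thesis using c order_trans by blast
qed

lemma run_reach:
  assumes "F s" "frame {10, 11, 13} F" and base: "\<And>s. F s \<Longrightarrow> base s \<and> s 8 0 = v \<and> s 9 0 = S"
    and S: "S < 2 ^ n" and v: "v \<in> bits S"
  shows "run reach_prog s (\<lambda>s'. F s' \<and> s' 13 0 < 2 ^ n \<and>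
    bits (s' 13 0) = {w. (v, w) \<in> (out_edges E (bits S))\<^sup>*})"
proof -
  let ?R = "out_edges E (bits S)"
  \<comment> \<open>Marks set during a pass are used in the same pass, so the marked set may run
    ahead of \<open>r\<close> steps. It is therefore bounded below by step counts and above by
    reachability.\<close>
  let ?I = "\<lambda>r s. F s \<and> s 13 0 < 2 ^ n \<and> bits (s 13 0) \<subseteq> {w. (v, w) \<in> ?R\<^sup>*} \<and>
    (\<forall>j\<le>r. \<forall>w. (v, w) \<in> ?R ^^ j \<longrightarrow> w \<in> bits (s 13 0))"
  have F: "\<And>s f. F s \<Longrightarrow> F (s(10 := f))" "\<And>s f. F s \<Longrightarrow> F (s(11 := f))"
    "\<And>s f. F s \<Longrightarrow> F (s(13 := f))"
    using assms(2) unfolding frame_def by auto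
  have vn: "v < n" using S v less_power_iff_bits[of S n] by auto
  have scal: "\<And>s. F s \<Longrightarrow> base s" "\<And>s. F s \<Longrightarrow> s 8 0 = v" "\<And>s. F s \<Longrightarrow> s 9 0 = S" using base by auto
  note base_simps = base_n[OF scal(1)] base_power[OF scal(1)] base_adj[OF scal(1)] scal(2,3)
  show ?thesis
    unfolding reach_prog_def
  proof (rule run_Seq, rule run_Store, goal_cases)
    case 4
    show ?case
    proof (rule run_For_mono[where m = "n * n" and I = ?I])
      fix r s assume r: "r < n * n" "?I r s" "s 11 0 = r"
      let ?J = "\<lambda>p s. ?I r s \<and> s 11 0 = r \<and>
        (\<forall>q<p. (v, q div n) \<in> ?R ^^ r \<longrightarrow> (q div n, q mod n) \<in> ?R \<longrightarrow> q mod n \<in> bits (s 13 0))"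
      show "run (For 10 pair_count
         (Cond (Bop Times (Cell 1 (scalar 10))
             (Bop Times (bit_test pair_fst (scalar 13)) (bit_test pair_fst (scalar 9))))
           (Store 13 (Const 0) (Bop BitOr (scalar 13) (power_of_two pair_snd))) Skip)) s
        (\<lambda>s'. s' 11 0 = r \<and> ?I (Suc r) (s'(11 := (s' 11)(0 := Suc r))))"
      proof (rule run_For_mono[where m = "n * n" and I = ?J])
        fix p s assume p: "p < n * n" "?J p s" "s 10 0 = p"
        let ?t = "Bop Times (Cell 1 (scalar 10))
             (Bop Times (bit_test pair_fst (scalar 13)) (bit_test pair_fst (scalar 9)))"
        note pl = pair_lt[OF p(1)]
        have t: "aval ?t s \<noteq> 0 \<longleftrightarrow> p div n \<in> bits (s 13 0) \<and> (p div n, p mod n) \<in> ?R"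
          using p pl by (auto simp: base_simps bit_value out_edges_def)
        show "run (Cond ?t (Store 13 (Const 0) (Bop BitOr (scalar 13) (power_of_two pair_snd))) Skip) s
          (\<lambda>s'. s' 10 0 = p \<and> ?J (Suc p) (s'(10 := (s' 10)(0 := Suc p))))"
        proof (rule run_Cond, unfold t)
          assume e: "p div n \<in> bits (s 13 0) \<and> (p div n, p mod n) \<in> ?R"
          let ?m = "Bit_Operations.or (s 13 0) (2 ^ (p mod n))"
          have b: "bits ?m = insert (p mod n) (bits (s 13 0))" by (simp add: bits_or bits_power)
          then have m: "?m < 2 ^ n" using p(2) pl(2) less_power_iff_bits by auto
          have "(v, p mod n) \<in> ?R\<^sup>*" using e p(2) by (auto intro: rtrancl_into_rtrancl)
          then show "run (Store 13 (Const 0) (Bop BitOr (scalar 13) (power_of_two pair_snd))) s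
            (\<lambda>s'. s' 10 0 = p \<and> ?J (Suc p) (s'(10 := (s' 10)(0 := Suc p))))"
            using p pl m b by (intro run_Store) (auto simp: F base_simps index_lt value_lt less_Suc_eq)
        next
          assume "aval ?t s = 0"
          then have "\<not> (p div n \<in> bits (s 13 0) \<and> (p div n, p mod n) \<in> ?R)" using t by blast
          then show "run Skip s (\<lambda>s'. s' 10 0 = p \<and> ?J (Suc p) (s'(10 := (s' 10)(0 := Suc p))))"
            using p by (intro run_Skip) (auto simp: F less_Suc_eq)
        qed
      next
        fix s assume J: "?J (n * n) s"
        have "w \<in> bits (s 13 0)" if "(v, w) \<in> ?R ^^ Suc r" for w
        proof -
          obtain x where x: "(v, x) \<in> ?R ^^ r" "(x, w) \<in> ?R" using \<open>(v, w) \<in> ?R ^^ Suc r\<close> by auto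
          then have "x < n" "w < n" using graph unfolding out_edges_def simple_graph_def by auto
          note enc = pair_encode[OF this]
          show ?thesis using J x enc(1) enc(2,3) by (metis (no_types, lifting))
        qed
        then show "s 11 0 = r \<and> ?I (Suc r) (s(11 := (s 11)(0 := Suc r)))"
          using J by (auto simp: F le_Suc_eq)
      qed (use r F in \<open>auto simp: nominal_state_def value_lt base_simps\<close>)
    next
      fix s assume "?I (n * n) s"
      then show "F s \<and> s 13 0 < 2 ^ n \<and> bits (s 13 0) = {w. (v, w) \<in> ?R\<^sup>*}"
        using out_edges_bits_rtrancl[OF S] by blast
    qed (use assms(1) F vn in \<open>auto simp: nominal_state_def value_lt base_simps bits_power\<close>)
  qed (use assms(1) vn in \<open>auto simp: index_lt value_lt base_simps\<close>)
qed


text \<open>\<open>b\<close> says whether the empty set or an earlier vertex has already settled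
  \<open>S\<close>; the attempt with \<open>v\<close> adds one disjunct of the recursion.\<close>

lemma run_try_vertex:
  fixes F :: "state \<Rightarrow> bool"
  defines "G \<equiv> \<lambda>v S k s. F s \<and> base s \<and> s 8 0 = v \<and> s 9 0 = S \<and>
    (\<forall>X<2 ^ n. s 6 X = cover_count k 0 X) \<and>
    (\<forall>X<S. s 7 X = of_bool (eliminable V E k (bits X)))"
  assumes G: "G v S k s" and fr: "frame {7, 10, 11, 13} F" and S: "S < 2 ^ n" and v: "v < n"
    and b: "s 7 S = of_bool b"
  shows "run try_vertex_prog s (\<lambda>s'. G v S k s' \<and> s' 7 S = of_bool (b \<or> v \<in> bits S \<and>
    eliminable V E k (bits (S - 2 ^ v)) \<and> clique_coverable V E k (elim_bag E (bits S) v)))"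
    (is "run _ s (\<lambda>s'. G v S k s' \<and> s' 7 S = of_bool (b \<or> _ \<and> ?el \<and> ?cov))")
proof -
  have F: "\<And>s f. F s \<Longrightarrow> F (s(7 := f))" "\<And>s f. F s \<Longrightarrow> F (s(10 := f))"
    "\<And>s f. F s \<Longrightarrow> F (s(11 := f))" "\<And>s f. F s \<Longrightarrow> F (s(13 := f))"
    using fr unfolding frame_def by auto
  have GD: "base s" "s 8 0 = v" "s 9 0 = S" "\<And>X. X < 2 ^ n \<Longrightarrow> s 6 X = cover_count k 0 X"
    "\<And>X. X < S \<Longrightarrow> s 7 X = of_bool (eliminable V E k (bits X))" if "G v S k s" for s
    using that unfolding G_def by auto
  let ?H = "\<lambda>s. G v S k s \<and> s 7 S = of_bool b"
  have t: "aval (bit_test (scalar 8) (scalar 9)) s \<noteq> 0 \<longleftrightarrow> v \<in> bits S"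
    using v GD[OF G] by (simp add: base_n base_power bit_value)
  show ?thesis
    unfolding try_vertex_prog_def
  proof (rule run_Cond, unfold t)
    assume vS: "v \<in> bits S"
    note rem = bits_remove[OF vS]
    have t2: "aval (Cell 7 rest_mask) s \<noteq> 0 \<longleftrightarrow> ?el"
      using v GD[OF G] rem(3) by (simp add: base_power)
    show "run (Cond (Cell 7 rest_mask) (Seq reach_prog
         (Cond (Cell 6 (Bop BitXor (scalar 13) (Bop BitAnd (scalar 13) rest_mask)))
           (Store 7 (scalar 9) (Const 1)) Skip)) Skip) s
      (\<lambda>s'. G v S k s' \<and> s' 7 S = of_bool (b \<or> v \<in> bits S \<and> ?el \<and> ?cov))"
    proof (rule run_Cond, unfold t2)
      assume el: ?el
      have "run reach_prog s (\<lambda>s'. ?H s' \<and> s' 13 0 < 2 ^ n \<and>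
          bits (s' 13 0) = {w. (v, w) \<in> (out_edges E (bits S))\<^sup>*})"
        using G b S vS by (intro run_reach) (auto simp: frame_def G_def F)
      then show "run (Seq reach_prog
         (Cond (Cell 6 (Bop BitXor (scalar 13) (Bop BitAnd (scalar 13) rest_mask)))
           (Store 7 (scalar 9) (Const 1)) Skip)) s
        (\<lambda>s'. G v S k s' \<and> s' 7 S = of_bool (b \<or> v \<in> bits S \<and> ?el \<and> ?cov))"
      proof (rule run_Seq[OF run_mono])
        fix s assume s: "?H s \<and> s 13 0 < 2 ^ n \<and> bits (s 13 0) = {w. (v, w) \<in> (out_edges E (bits S))\<^sup>*}"
        let ?e = "Bop BitXor (scalar 13) (Bop BitAnd (scalar 13) rest_mask)"
        have Gs: "G v S k s" using s by blast
        have ev: "aval ?e s = Bit_Operations.xor (s 13 0) (Bit_Operations.and (s 13 0) (S - 2 ^ v))"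
          using v GD(1-3)[OF Gs] by (simp add: base_power)
        then have bag: "bits (aval ?e s) = elim_bag E (bits S) v"
          using s rem(1) by (simp add: bits_diff elim_bag_def)
        have "bits (aval ?e s) \<subseteq> bits (s 13 0)" unfolding ev bits_diff by blast
        then have "aval ?e s < 2 ^ n" using s less_power_iff_bits[of _ n] by (meson order_trans)
        then have t3: "aval (Cell 6 ?e) s \<noteq> 0 \<longleftrightarrow> ?cov"
          using cover_count_0_pos_iff[of k "aval ?e s"] GD(4)[OF Gs] unfolding bag[symmetric]
          by (simp del: aval.simps(3))
        show "run (Cond (Cell 6 ?e) (Store 7 (scalar 9) (Const 1)) Skip) s
          (\<lambda>s'. G v S k s' \<and> s' 7 S = of_bool (b \<or> v \<in> bits S \<and> ?el \<and> ?cov))"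
        proof (rule run_Cond, unfold t3)
          assume ?cov
          then show "run (Store 7 (scalar 9) (Const 1)) s
            (\<lambda>s'. G v S k s' \<and> s' 7 S = of_bool (b \<or> v \<in> bits S \<and> ?el \<and> ?cov))"
            using Gs vS el S by (intro run_Store) (auto simp: G_def F index_lt value_lt)
        next
          assume "aval (Cell 6 ?e) s = 0"
          then have "\<not> ?cov" using t3 by blast
          then show "run Skip s (\<lambda>s'. G v S k s' \<and> s' 7 S = of_bool (b \<or> v \<in> bits S \<and> ?el \<and> ?cov))"
            using s by (intro run_Skip) auto
        qed
      qed
    next
      assume "aval (Cell 7 rest_mask) s = 0"
      then have "\<not> ?el" using t2 by blast
      then show "run Skip s (\<lambda>s'. G v S k s' \<and> s' 7 S = of_bool (b \<or> v \<in> bits S \<and> ?el \<and> ?cov))"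
        using G b by (intro run_Skip) auto
    qed
  next
    assume "aval (bit_test (scalar 8) (scalar 9)) s = 0"
    then have "v \<notin> bits S" using t by blast
    then show "run Skip s (\<lambda>s'. G v S k s' \<and> s' 7 S = of_bool (b \<or> v \<in> bits S \<and> ?el \<and> ?cov))"
      using G b by (intro run_Skip) auto
  qed
qed

text \<open>All masks below \<open>S\<close> are final when \<open>S\<close> is treated, and its
  cell starts with the test for the empty set, the base case of the recursion.\<close>

lemma run_eliminable:
  assumes "F s" and fr: "frame {7, 8, 9, 10, 11, 13} F" and base: "\<And>s. F s \<Longrightarrow> base s"
    and init: "\<forall>X<2 ^ n. s 6 X = cover_count k 0 X"
  shows "run eliminable_prog s (\<lambda>s'. F s' \<and> (\<forall>X<2 ^ n. s' 7 X = of_bool (eliminable V E k (bits X))))"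
proof -
  let ?el = "\<lambda>X. eliminable V E k (bits X)"
  let ?I = "\<lambda>S s. F s \<and> (\<forall>X<2 ^ n. s 6 X = cover_count k 0 X) \<and> (\<forall>X<S. s 7 X = of_bool (?el X))"
  let ?step = "\<lambda>S v. v \<in> bits S \<and> ?el (S - 2 ^ v) \<and> clique_coverable V E k (elim_bag E (bits S) v)"
  have F: "\<And>s f. F s \<Longrightarrow> F (s(7 := f))" "\<And>s f. F s \<Longrightarrow> F (s(8 := f))" "\<And>s f. F s \<Longrightarrow> F (s(9 := f))"
    using fr unfolding frame_def by auto
  have fr': "frame {7, 10, 11, 13} F" using fr unfolding frame_def by blast
  note base_simps = base_n[OF base] base_power[OF base]
  show ?thesis
    unfolding eliminable_prog_def
  proof (rule run_For_mono[where m = "2 ^ n" and I = ?I])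
    fix S s assume S: "S < 2 ^ n" "?I S s" "s 9 0 = S"
    have el: "?el S \<longleftrightarrow> S = 0 \<or> (\<exists>v<n. ?step S v)"
      using eliminable_bits_iff[OF S(1)] S(1) less_power_iff_bits[of S n] by blast
    let ?J = "\<lambda>v s. ?I S s \<and> s 9 0 = S \<and> s 7 S = of_bool (S = 0 \<or> (\<exists>u<v. ?step S u))"
    show "run (Seq (Store 7 (scalar 9) (Bop Equal (scalar 9) (Const 0))) (For 8 vertex_count try_vertex_prog)) s
      (\<lambda>s'. s' 9 0 = S \<and> ?I (Suc S) (s'(9 := (s' 9)(0 := Suc S))))"
    proof (rule run_Seq, rule run_Store, goal_cases)
      case 4
      show ?case
      proof (rule run_For_mono[where m = n and I = ?J])
        fix v s assume v: "v < n" "?J v s" "s 8 0 = v"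
        have "run try_vertex_prog s (\<lambda>s'. (F s' \<and> base s' \<and> s' 8 0 = v \<and> s' 9 0 = S \<and>
            (\<forall>X<2 ^ n. s' 6 X = cover_count k 0 X) \<and> (\<forall>X<S. s' 7 X = of_bool (?el X))) \<and>
            s' 7 S = of_bool ((S = 0 \<or> (\<exists>u<v. ?step S u)) \<or> ?step S v))"
          using v S(1) base fr' by (intro run_try_vertex) auto
        then show "run try_vertex_prog s (\<lambda>s'. s' 8 0 = v \<and> ?J (Suc v) (s'(8 := (s' 8)(0 := Suc v))))"
          by (rule run_mono) (auto simp: F less_Suc_eq)
      next
        fix s assume "?J n s"
        then show "s 9 0 = S \<and> ?I (Suc S) (s(9 := (s 9)(0 := Suc S)))"
          unfolding el[symmetric] by (auto simp: F less_Suc_eq)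
      qed (use S F in \<open>auto simp: nominal_state_def value_lt base_simps\<close>)
    qed (use S in \<open>auto simp: index_lt value_lt\<close>)
  qed (use assms(1) init F in \<open>auto simp: nominal_state_def value_lt base_simps\<close>)
qed

definition round_invar :: "nat \<Rightarrow> state \<Rightarrow> bool" where
  "round_invar k s \<longleftrightarrow> base s \<and> (\<forall>X<2 ^ n. s 4 X = clique_count X \<and> s 5 X = clique_count X ^ k) \<and>
     s 14 0 = card {j. j < k \<and> \<not> eliminable V E j V}"

lemma run_round:
  assumes k: "k < n" and inv: "round_invar k s" and s12: "s 12 0 = k"
  shows "run round_prog s (\<lambda>s'. s' 12 0 = k \<and> round_invar (Suc k) s')"
proof -
  \<comment> \<open>Array 5 is absent from \<open>?F\<close> because preparing the next power
    changes it; \<open>?F5\<close> adds it afterwards.\<close>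
  let ?F = "\<lambda>s. base s \<and> (\<forall>X<2 ^ n. s 4 X = clique_count X) \<and> s 12 0 = k \<and>
    s 14 0 = card {j. j < k \<and> \<not> eliminable V E j V}"
  let ?F5 = "\<lambda>s. ?F s \<and> (\<forall>X<2 ^ n. s 5 X = clique_count X ^ Suc k)"
  have card: "card {j. j < Suc k \<and> \<not> eliminable V E j V} =
      card {j. j < k \<and> \<not> eliminable V E j V} + of_bool (\<not> eliminable V E k V)"
  proof -
    have split: "{j. j < Suc k \<and> \<not> eliminable V E j V} = {j. j < k \<and> \<not> eliminable V E j V} \<union>
        (if eliminable V E k V then {} else {k})" by (auto simp: less_Suc_eq)
    then show ?thesis unfolding split by (auto simp: card_insert_if)
  qed
  have "card {j. j < Suc k \<and> \<not> eliminable V E j V} \<le> card {..<Suc k}" by (intro card_mono) auto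
  then have bound: "card {j. j < Suc k \<and> \<not> eliminable V E j V} \<le> n" using k by simp
  show ?thesis
    unfolding round_prog_def
  proof (rule run_Seq, rule run_mono)
    show "run next_power_prog s (\<lambda>s'. ?F s' \<and>
        (\<forall>X<2 ^ n. s' 5 X = clique_count X ^ Suc k \<and> s' 6 X = clique_count X ^ k))"
      using inv s12 k by (intro run_next_power) (auto simp: frame_def round_invar_def)
    fix s assume s: "?F s \<and> (\<forall>X<2 ^ n. s 5 X = clique_count X ^ Suc k \<and> s 6 X = clique_count X ^ k)"
    show "run (Seq moebius_prog (Seq eliminable_prog
       (Store 14 (Const 0) (Bop Plus (scalar 14)
         (Bop Equal (Cell 7 (Bop Minus mask_count (Const 1))) (Const 0)))))) s
      (\<lambda>s'. s' 12 0 = k \<and> round_invar (Suc k) s')"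
    proof (rule run_Seq, rule run_mono)
      show "run moebius_prog s (\<lambda>s'. ?F5 s' \<and> (\<forall>X<2 ^ n. s' 6 X = cover_count k 0 X))"
        using s k by (intro run_moebius) (auto simp: frame_def)
      fix s assume s: "?F5 s \<and> (\<forall>X<2 ^ n. s 6 X = cover_count k 0 X)"
      show "run (Seq eliminable_prog (Store 14 (Const 0) (Bop Plus (scalar 14)
           (Bop Equal (Cell 7 (Bop Minus mask_count (Const 1))) (Const 0))))) s
        (\<lambda>s'. s' 12 0 = k \<and> round_invar (Suc k) s')"
      proof (rule run_Seq, rule run_mono)
        show "run eliminable_prog s (\<lambda>s'. ?F5 s' \<and>
            (\<forall>X<2 ^ n. s' 7 X = of_bool (eliminable V E k (bits X))))"
          using s by (intro run_eliminable) (auto simp: frame_def)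
        fix s assume s: "?F5 s \<and> (\<forall>X<2 ^ n. s 7 X = of_bool (eliminable V E k (bits X)))"
        let ?e = "Bop Plus (scalar 14) (Bop Equal (Cell 7 (Bop Minus mask_count (Const 1))) (Const 0))"
        have "s 7 (2 ^ n - 1) = of_bool (eliminable V E k V)" using s by (simp flip: bits_full)
        then have "aval ?e s = card {j. j < Suc k \<and> \<not> eliminable V E j V}"
          using s unfolding card by (simp add: base_n base_power)
        then show "run (Store 14 (Const 0) ?e) s (\<lambda>s'. s' 12 0 = k \<and> round_invar (Suc k) s')"
          using s bound by (intro run_Store) (auto simp: index_lt value_lt round_invar_def simp del: aval.simps(2,3) power_Suc)
      qed
    qed
  qed
qed

lemma run_tcl_prog:
  assumes "input_ok s" "s 14 0 = 0"
  shows "run tcl_prog s (\<lambda>s'. result s' = tcl V E)"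
  unfolding tcl_prog_def
proof (rule run_Seq, rule run_mono)
  let ?F = "\<lambda>s. s 14 0 = (0 :: nat)"
  show "run powers_prog s (\<lambda>s'. ?F s' \<and> base s')"
    using assms by (intro run_powers) (auto simp: frame_def)
  fix s assume s: "?F s \<and> base s"
  show "run (Seq cliques_prog (Seq zeta_prog (Seq (For 12 vertex_count round_prog)
      (Store 0 (Const 0) (scalar 14))))) s (\<lambda>s'. result s' = tcl V E)"
  proof (rule run_Seq, rule run_mono)
    show "run cliques_prog s (\<lambda>s'. ?F s' \<and> base s' \<and>
        (\<forall>X<2 ^ n. s' 4 X = of_bool (clique V E (bits X)) \<and> s' 5 X = 1))"
      using s by (intro run_cliques) (auto simp: frame_def)
    fix s assume s: "?F s \<and> base s \<and> (\<forall>X<2 ^ n. s 4 X = of_bool (clique V E (bits X)) \<and> s 5 X = 1)"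
    let ?F5 = "\<lambda>s. ?F s \<and> base s \<and> (\<forall>X<2 ^ n. s 5 X = 1)"
    show "run (Seq zeta_prog (Seq (For 12 vertex_count round_prog)
      (Store 0 (Const 0) (scalar 14)))) s (\<lambda>s'. result s' = tcl V E)"
    proof (rule run_Seq, rule run_mono)
      show "run zeta_prog s (\<lambda>s'. ?F5 s' \<and> (\<forall>X<2 ^ n. s' 4 X = clique_count X))"
        using s by (intro run_zeta) (auto simp: frame_def)
      fix s assume s: "?F5 s \<and> (\<forall>X<2 ^ n. s 4 X = clique_count X)"
      show "run (Seq (For 12 vertex_count round_prog) (Store 0 (Const 0) (scalar 14))) s
        (\<lambda>s'. result s' = tcl V E)"
      proof (rule run_Seq, rule run_For_mono[where m = n and I = round_invar])
        fix k s assume "k < n" "round_invar k s" "s 12 0 = k"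
        from run_round[OF this] show "run round_prog s
            (\<lambda>s'. s' 12 0 = k \<and> round_invar (Suc k) (s'(12 := (s' 12)(0 := Suc k))))"
          by (rule run_mono) (auto simp: round_invar_def)
      next
        fix s assume "round_invar n s"
        then have "s 14 0 = tcl V E" using card_not_eliminable unfolding round_invar_def by simp
        moreover have "tcl V E \<le> n" using eliminable_card[OF graph] tcl_le_iff[OF graph] by simp
        ultimately show "run (Store 0 (Const 0) (scalar 14)) s (\<lambda>s'. result s' = tcl V E)"
          by (intro run_Store) (auto simp: index_lt value_lt result_def)
      qed (use s in \<open>auto simp: round_invar_def nominal_state_def value_lt base_n\<close>)
    qed
  qed
qed

end

text \<open>A list of distinct subsets of the vertices cannot be longer than this; the bound lets
  the initial state fit into the claimed space.\<close>

lemma minimal_separators_length: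
  assumes "distinct Ss" "set Ss = {S. minimal_separator {..<n} E S}"
  shows "length Ss \<le> 2 ^ n"
proof -
  have "set Ss \<subseteq> Pow {..<n}"
    using assms(2) unfolding minimal_separator_def minimal_separator_between_def separator_def by auto
  then have "card (set Ss) \<le> card (Pow {..<n})" by (intro card_mono) auto
  then show "length Ss \<le> 2 ^ n" using distinct_card[OF assms(1)] by (simp add: card_Pow)
qed

lemma small_input_state:
  assumes len: "length Ss \<le> 2 ^ n"
  shows "small (index_bound n) (word_length n) (input_state n E Ss)"
  unfolding small_def
proof (intro allI impI)
  fix x i assume nz: "input_state n E Ss x i \<noteq> 0"
  have n: "n < 2 ^ n" by (rule less_exp)
  have p: "(1::nat) \<le> 2 ^ n" by simp
  have big: "2 ^ n < (2 ^ word_length n :: nat)"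
    by (rule power_strict_increasing) (auto simp: word_length_def)
  have ib: "index_bound n = n * 2 ^ n + 2 * 2 ^ n" unfolding index_bound_def by (simp add: algebra_simps)
  have le: "n * n \<le> n * 2 ^ n" "length Ss * n \<le> n * 2 ^ n"
    using mult_le_mono2[OF less_imp_le[OF n], of n] mult_le_mono1[OF len, of n]
    by (simp_all only: mult.commute)
  have "x = 0 \<and> i \<le> 1 \<or> x = 1 \<and> i < n * n \<or> x = 2 \<and> i < length Ss * n"
    using nz unfolding input_state_def by (auto split: if_splits)
  then have "x < 16 \<and> i < n * 2 ^ n + 2 * 2 ^ n" using le p by linarith
  moreover have "input_state n E Ss x i \<le> 2 ^ n"
    using n p len unfolding input_state_def by auto
  ultimately show "x < 16 \<and> i < index_bound n \<and> input_state n E Ss x i < 2 ^ word_length n"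
    using big ib by linarith
qed


section \<open>Growth rates\<close>

lemma O_star_mono:
  assumes "0 < c" "c \<le> d" "f \<in> O_star c"
  shows "f \<in> O_star d"
proof -
  obtain k where f: "f \<in> O(\<lambda>n. real n ^ k * c ^ n)" using assms(3) unfolding O_star_def by blast
  have "(\<lambda>n. real n ^ k * c ^ n) \<in> O(\<lambda>n. real n ^ k * d ^ n)"
    using assms(1,2) by (intro bigoI[of _ 1] always_eventually allI) (simp add: abs_mult mult_left_mono power_mono)
  then show ?thesis using f landau_o.big_trans unfolding O_star_def by blast
qed

lemma O_star_add:
  assumes "f \<in> O_star c" "g \<in> O_star c"
  shows "(\<lambda>n. f n + g n) \<in> O_star c"
proof -
  obtain k l where f: "f \<in> O(\<lambda>n. real n ^ k * c ^ n)" and g: "g \<in> O(\<lambda>n. real n ^ l * c ^ n)"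
    using assms unfolding O_star_def by blast
  \<comment> \<open>Raising an exponent needs \<open>1 \<le> n\<close>: at \<open>n = 0\<close> the
    zeroth power is 1 while the others vanish.\<close>
  have up: "(\<lambda>n. real n ^ i * c ^ n) \<in> O(\<lambda>n. real n ^ (k + l) * c ^ n)" if "i \<le> k + l" for i
    using that
    by (intro bigoI[of _ 1] eventually_mono[OF eventually_ge_at_top[of 1]])
      (auto simp: abs_mult intro!: mult_right_mono power_increasing)
  have "(\<lambda>n. f n + g n) \<in> O(\<lambda>n. real n ^ (k + l) * c ^ n)"
    using landau_o.big_trans[OF f up] landau_o.big_trans[OF g up] by (intro sum_in_bigo) auto
  then show ?thesis unfolding O_star_def by blast
qed

lemma O_star_mult:
  assumes "f \<in> O_star c" "g \<in> O_star d"
  shows "(\<lambda>n. f n * g n) \<in> O_star (c * d)"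
proof -
  obtain k l where f: "f \<in> O(\<lambda>n. real n ^ k * c ^ n)" and g: "g \<in> O(\<lambda>n. real n ^ l * d ^ n)"
    using assms unfolding O_star_def by blast
  have "(\<lambda>n. f n * g n) \<in> O(\<lambda>n. (real n ^ k * c ^ n) * (real n ^ l * d ^ n))"
    by (rule landau_o.big.mult[OF f g])
  also have "(\<lambda>n. (real n ^ k * c ^ n) * (real n ^ l * d ^ n)) = (\<lambda>n. real n ^ (k + l) * (c * d) ^ n)"
    by (simp add: power_add power_mult_distrib mult_ac)
  finally show ?thesis unfolding O_star_def by blast
qed

lemma O_star_const: "1 \<le> c \<Longrightarrow> (\<lambda>n. a) \<in> O_star c"
  by (rule O_star_mono[of 1]) (auto simp: O_star_def intro!: exI[of _ 0])

lemma O_star_id: "1 \<le> c \<Longrightarrow> real \<in> O_star c"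
  by (rule O_star_mono[of 1]) (auto simp: O_star_def intro!: exI[of _ 1])

lemma O_star_power: "(\<lambda>n. c ^ n) \<in> O_star c"
  unfolding O_star_def by (auto intro!: exI[of _ 0])

lemma O_star_poly_mult:
  "\<lbrakk> f \<in> O_star 1; g \<in> O_star c \<rbrakk> \<Longrightarrow> (\<lambda>n. f n * g n) \<in> O_star c"
  "\<lbrakk> g \<in> O_star c; f \<in> O_star 1 \<rbrakk> \<Longrightarrow> (\<lambda>n. g n * f n) \<in> O_star c"
  using O_star_mult[of f 1 g c] O_star_mult[of g c f 1] by auto

lemma O_star_word_length: "(\<lambda>n. real (word_length n)) \<in> O_star 1"
  unfolding word_length_def of_nat_add of_nat_mult
  by (intro O_star_add O_star_poly_mult(1) O_star_const O_star_id) auto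

lemma O_star_nominal:
  "(\<lambda>n. real (aval vertex_count (nominal_state n))) \<in> O_star 1"
  "(\<lambda>n. real (aval pair_count (nominal_state n))) \<in> O_star 1"
  "(\<lambda>n. real (aval mask_count (nominal_state n))) \<in> O_star 2"
  using O_star_poly_mult(1)[OF O_star_id O_star_id, of 1] O_star_id[of 1] O_star_power[of 2]
  by (simp_all add: nominal_state_def)


section \<open>Growth of the running time\<close>

abbreviation "units_fun c \<equiv> \<lambda>n. real (units (nominal_state n) c)"

lemma O_star_units_basic:
  assumes "1 \<le> c"
  shows "units_fun Skip \<in> O_star c" "units_fun (Store x e1 e2) \<in> O_star c"
  using assms by (auto intro: O_star_const)

lemma O_star_units_Seq:
  "\<lbrakk> units_fun c1 \<in> O_star c; units_fun c2 \<in> O_star c \<rbrakk> \<Longrightarrow> units_fun (Seq c1 c2) \<in> O_star c"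
  using O_star_add by simp

lemma O_star_units_Cond:
  assumes "1 \<le> c" "units_fun c1 \<in> O_star c" "units_fun c2 \<in> O_star c"
  shows "units_fun (Cond e c1 c2) \<in> O_star c"
  unfolding units.simps of_nat_add by (intro O_star_add O_star_const assms)

lemma O_star_units_For:
  assumes "1 \<le> c" "1 \<le> d" "(\<lambda>n. real (aval e (nominal_state n))) \<in> O_star d"
    "units_fun body \<in> O_star c"
  shows "units_fun (For x e body) \<in> O_star (d * c)"
proof -
  have dc: "1 \<le> d * c" using mult_mono[OF assms(2,1)] assms(1,2) by simp
  show ?thesis
    unfolding For_def units.simps iterations.simps of_nat_add of_nat_mult
    by (intro O_star_add O_star_mult O_star_const assms dc)
qed

lemma O_star_units_For_poly:
  assumes "1 \<le> c" "units_fun body \<in> O_star c"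
  shows "units_fun (For x vertex_count body) \<in> O_star c"
    "units_fun (For x pair_count body) \<in> O_star c"
  using O_star_units_For[OF assms(1) _ O_star_nominal(1) assms(2)]
    O_star_units_For[OF assms(1) _ O_star_nominal(2) assms(2)] by simp_all

text \<open>Loops over masks are never nested in \<open>tcl_prog\<close>, so a polynomial body is
  all that is required and the base stays 2.\<close>

lemma O_star_units_For_masks:
  "units_fun body \<in> O_star 1 \<Longrightarrow> units_fun (For x mask_count body) \<in> O_star 2"
  using O_star_units_For[OF _ _ O_star_nominal(3)] by force

lemma O_star_units_tcl_prog: "units_fun tcl_prog \<in> O_star 2"
  unfolding tcl_prog_def powers_prog_def cliques_prog_def zeta_prog_def round_prog_def
    next_power_prog_def moebius_prog_def eliminable_prog_def try_vertex_prog_def reach_prog_def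
  by (intro O_star_units_Seq O_star_units_For_masks O_star_units_For_poly O_star_units_Cond
      O_star_units_basic) simp_all

theorem theorem11:
  "\<exists>P :: com. \<exists>T \<in> O_star 2.4423. \<exists>M \<in> O_star 2.
     \<forall>(n :: nat) (E :: nat set set) (Ss :: nat set list).
       simple_graph {..<n} E \<and> distinct Ss \<and> set Ss = {S. minimal_separator {..<n} E S} \<longrightarrow>
       (\<exists>t m s. big_step P (input_state n E Ss) t m s \<and>
          result s = tcl {..<n} E \<and> real t \<le> T n \<and> real m \<le> M n)"
proof -
  let ?T = "\<lambda>n. real (units (nominal_state n) tcl_prog * (word_length n + 1)\<^sup>2)"
  let ?M = "\<lambda>n. real (16 * index_bound n * (1 + 2 * word_length n))"
  have "?T \<in> O_star 2"
    unfolding of_nat_mult of_nat_add power2_eq_square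
    by (intro O_star_poly_mult(2)[OF O_star_units_tcl_prog] O_star_poly_mult(1) O_star_add
        O_star_word_length O_star_const) simp_all
  \<comment> \<open>The program meets base 2, which is below the base in the claim.\<close>
  then have T: "?T \<in> O_star 2.4423" by (rule O_star_mono[rotated 2]) simp_all
  have "(\<lambda>n. real n + real 2) \<in> O_star 1"
    by (intro O_star_add O_star_id O_star_const) simp_all
  moreover have "(\<lambda>n. real (2 ^ n)) \<in> O_star 2" using O_star_power[of 2] by simp
  ultimately have "(\<lambda>n. real 16 * ((real n + real 2) * real (2 ^ n))) \<in> O_star 2"
    by (intro O_star_poly_mult(1)[OF O_star_const] O_star_poly_mult(1)) simp_all
  then have M: "?M \<in> O_star 2"
    unfolding of_nat_mult of_nat_add index_bound_def
    by (rule O_star_poly_mult(2))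
      (intro O_star_poly_mult(1) O_star_add O_star_word_length O_star_const; simp)
  have main: "\<exists>t m s. big_step tcl_prog (input_state n E Ss) t m s \<and>
      result s = tcl {..<n} E \<and> real t \<le> ?T n \<and> real m \<le> ?M n"
    if asm: "simple_graph {..<n} E \<and> distinct Ss \<and> set Ss = {S. minimal_separator {..<n} E S}"
    for n E Ss
  proof -
    interpret tcl_instance n E by unfold_locales (use asm in simp)
    have "length Ss \<le> 2 ^ n" using minimal_separators_length asm by blast
    then have "small (index_bound n) (word_length n) (input_state n E Ss)"
      by (rule small_input_state)
    moreover have "run tcl_prog (input_state n E Ss) (\<lambda>s'. result s' = tcl V E)"
      by (rule run_tcl_prog) (auto simp: input_ok_def input_state_def)
    ultimately obtain t m s where "big_step tcl_prog (input_state n E Ss) t m s"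
      "t \<le> units (nominal_state n) tcl_prog * (word_length n + 1)\<^sup>2"
      "m \<le> 16 * index_bound n * (1 + 2 * word_length n)" "result s = tcl V E"
      unfolding run_def by blast
    then show ?thesis using of_nat_mono by blast
  qed
  show ?thesis
    by (intro exI[of _ tcl_prog] bexI[OF _ T] bexI[OF _ M] allI impI main)
qed

end
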